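(* Let $F_2$ be the free group in two generators. Every subgroup of the oriented outer automorphism group $\mathrm{Out}^+(F_2)$ is the stabiliser in $\mathrm{Out}^+(F_2)$ of the conjugacy class $[U]$ of some (possibly infinite index) subgroup $U$ of $F_2$.
   Context: $\mathrm{Out}(F_2)$ acts naturally on the set of conjugacy classes of subgroups of $F_2$ (the class of an automorphism $\varphi$ sends $[U]$ to $[\varphi(U)]$). $\mathrm{Out}(F_2)$ is isomorphic to $\mathrm{GL}_2(\mathbb{Z})$ via the action on the abelianisation $\mathbb{Z}^2$ of $F_2$, and $\mathrm{Out}^+(F_2)$ is the subgroup corresponding to $\mathrm{SL}_2(\mathbb{Z})$. *)

theory Defs
  imports "HOL-Algebra.Algebra" "HOL-Analysis.Determinants"
begin

section \<open>Free groups\<close>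

text \<open>The letters \<open>(x, True)\<close> and \<open>(x, False)\<close> stand for the generator \<open>x\<close> and its formal inverse.
  The free group on the type \<open>'g\<close> consists of the reduced words in these letters.\<close>

definition letter_inv :: "'g \<times> bool \<Rightarrow> 'g \<times> bool"
  where "letter_inv a = (fst a, \<not> snd a)"

definition reduced :: "('g \<times> bool) list \<Rightarrow> bool"
  where "reduced w \<longleftrightarrow> successively (\<lambda>a b. b \<noteq> letter_inv a) w"

fun push :: "'g \<times> bool \<Rightarrow> ('g \<times> bool) list \<Rightarrow> ('g \<times> bool) list"
  where
    "push a [] = [a]"
  | "push a (b # w) = (if b = letter_inv a then w else a # b # w)"

definition free_group :: "('g \<times> bool) list monoid"
  where "free_group = \<lparr>carrier = {w. reduced w}, monoid.mult = (\<lambda>u v. foldr push u v), one = []\<rparr>"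

abbreviation gen :: "'g \<Rightarrow> ('g \<times> bool) list"
  where "gen x \<equiv> [(x, True)]"

abbreviation F2 :: "(2 \<times> bool) list monoid"
  where "F2 \<equiv> free_group"

lemma letter_inv_inv [simp]: "letter_inv (letter_inv a) = a"
  by (simp add: letter_inv_def)

lemma letter_inv_neq [simp]: "letter_inv a \<noteq> a" "a \<noteq> letter_inv a"
  by (auto simp: letter_inv_def prod_eq_iff)

lemma reduced_simps [simp]:
  "reduced []" "reduced [a]"
  "reduced (a # b # w) \<longleftrightarrow> b \<noteq> letter_inv a \<and> reduced (b # w)"
  by (simp_all add: reduced_def)

lemma reduced_tl: "reduced (a # w) \<Longrightarrow> reduced w"
  by (cases w) auto

lemma reduced_push: "reduced w \<Longrightarrow> reduced (push a w)"
  by (cases w) (auto dest: reduced_tl)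

lemma reduced_foldr_push: "reduced w \<Longrightarrow> reduced (foldr push u w)"
  by (induction u) (auto intro: reduced_push)

lemma push_reduced: "reduced (a # w) \<Longrightarrow> push a w = a # w"
  by (cases w) auto

lemma push_push_inv: "reduced w \<Longrightarrow> push a (push (letter_inv a) w) = w"
  by (cases w) (auto simp: push_reduced)

lemma foldr_push_push:
  assumes "reduced w"
  shows "foldr push (push a x) w = push a (foldr push x w)"
  using assms by (cases x) (auto simp: push_push_inv reduced_foldr_push)

lemma foldr_push_assoc:
  assumes "reduced w"
  shows "foldr push (foldr push u v) w = foldr push u (foldr push v w)"
  using assms by (induction u) (simp_all add: foldr_push_push)

lemma foldr_push_Nil: "reduced w \<Longrightarrow> foldr push w [] = w"
proof (induction w)
  case (Cons a w)
  then show ?case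
    using reduced_tl[of a w] push_reduced[of a w] by simp
qed simp

lemma foldr_push_inverse:
  "reduced v \<Longrightarrow> foldr push (rev (map letter_inv w)) (foldr push w v) = v"
proof (induction w arbitrary: v)
  case (Cons a w)
  have "push (letter_inv a) (push a (foldr push w v)) = foldr push w v"
    using push_push_inv[of "foldr push w v" "letter_inv a"] Cons.prems
    by (simp add: reduced_foldr_push)
  with Cons show ?case by simp
qed simp

lemma free_group_simps [simp]:
  "carrier free_group = {w. reduced w}"
  "u \<otimes>\<^bsub>free_group\<^esub> v = foldr push u v"
  "\<one>\<^bsub>free_group\<^esub> = []"
  by (simp_all add: free_group_def)

theorem group_free_group: "group (free_group :: ('g \<times> bool) list monoid)"
proof (rule groupI)
  fix w :: "('g \<times> bool) list"
  assume w: "w \<in> carrier free_group"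
  let ?v = "foldr push (rev (map letter_inv w)) []"
  have "foldr push ?v w = foldr push (rev (map letter_inv w)) w"
    using w by (simp add: foldr_push_assoc)
  also have "\<dots> = []"
    using foldr_push_inverse[of "[]" w] w by (simp add: foldr_push_Nil)
  finally show "\<exists>v\<in>carrier free_group. v \<otimes>\<^bsub>free_group\<^esub> w = \<one>\<^bsub>free_group\<^esub>"
    by (intro bexI[of _ ?v]) (auto simp: reduced_foldr_push)
qed (auto simp: reduced_foldr_push foldr_push_assoc)

lemma inv_gen: "inv\<^bsub>free_group\<^esub> [(x, True)] = [(x, False)]"
  by (rule group.inv_equality[OF group_free_group]) (auto simp: letter_inv_def)

text \<open>The universal property.\<close>

lemma free_group_hom_eq:
  assumes G: "group G"
    and h: "h \<in> hom free_group G" and k: "k \<in> hom free_group G"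
    and gens: "\<And>x. h (gen x) = k (gen x)"
    and w: "reduced w"
  shows "h w = k w"
  using w
proof (induction w)
  case Nil
  show ?case
    using hom_one[OF h group_free_group G] hom_one[OF k group_free_group G] by simp
next
  case (Cons a w)
  have inv: "f [(x, False)] = inv\<^bsub>G\<^esub> f (gen x)" if "f \<in> hom free_group G" for f x
    using group_hom.hom_inv[of free_group G f "gen x"] that G group_free_group
    by (simp add: group_hom_def group_hom_axioms_def inv_gen)
  have "h [a] = k [a]"
    by (cases a; cases "snd a") (auto simp: gens inv[OF h] inv[OF k])
  moreover have "f (a # w) = f [a] \<otimes>\<^bsub>G\<^esub> f w" if "f \<in> hom free_group G" for f
    using hom_mult[OF that, of "[a]" w] push_reduced[OF Cons.prems] reduced_tl[OF Cons.prems] by simp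
  ultimately show ?case
    using Cons.IH[OF reduced_tl[OF Cons.prems]] h k by metis
qed

theorem free_group_universal:
  fixes G (structure) and f :: "'g \<Rightarrow> 'a"
  assumes "group G" and f: "range f \<subseteq> carrier G"
  shows "\<exists>!h. h \<in> hom free_group G \<inter> extensional (carrier free_group) \<and> (\<forall>x. h (gen x) = f x)"
proof -
  interpret group G by fact
  define l where "l a = (if snd a then f (fst a) else inv (f (fst a)))" for a
  define e where "e w = foldr (\<lambda>a g. l a \<otimes> g) w \<one>" for w
  have fc: "f x \<in> carrier G" for x
    using f by auto
  have lc: "l a \<in> carrier G" for a
    using fc by (simp add: l_def)
  have ec: "e w \<in> carrier G" for w
    by (induction w) (auto simp: e_def lc)
  have cancel: "l a \<otimes> (l (letter_inv a) \<otimes> g) = g" if "g \<in> carrier G" for a g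
  proof -
    have "l a \<otimes> l (letter_inv a) = \<one>"
      using fc by (simp add: l_def letter_inv_def)
    then show ?thesis
      using that lc by (simp flip: m_assoc)
  qed
  have push: "e (push a w) = l a \<otimes> e w" for a w
  proof (cases w)
    case (Cons b v)
    then show ?thesis
      using cancel[OF ec[of v], of a] by (simp add: e_def)
  qed (simp add: e_def)
  have mult: "e (foldr push u v) = e u \<otimes> e v" for u v
    by (induction u) (auto simp: push ec lc m_assoc, auto simp: e_def ec[unfolded e_def] lc m_assoc)
  show ?thesis
  proof (rule ex1I[of _ "restrict e (carrier free_group)"])
    show "restrict e (carrier free_group) \<in> hom free_group G \<inter> extensional (carrier free_group) \<and>
        (\<forall>x. restrict e (carrier free_group) (gen x) = f x)"
      using fc by (auto simp: hom_def ec mult reduced_foldr_push) (simp add: e_def l_def)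
    then have e: "restrict e (carrier free_group) \<in> hom free_group G"
        "\<And>x. restrict e (carrier free_group) (gen x) = f x"
      by blast+
    show "h = restrict e (carrier free_group)"
      if "h \<in> hom free_group G \<inter> extensional (carrier free_group) \<and> (\<forall>x. h (gen x) = f x)" for h
    proof (rule extensionalityI)
      show "h \<in> extensional (carrier free_group)"
        using that by blast
      show "h w = restrict e (carrier free_group) w" if "w \<in> carrier free_group" for w
        using free_group_hom_eq[OF \<open>group G\<close> _ e(1), of h w] e(2) that
          \<open>h \<in> hom free_group G \<inter> extensional (carrier free_group) \<and> (\<forall>x. h (gen x) = f x)\<close>
        by (metis IntE free_group_simps(1) mem_Collect_eq)
    qed (rule restrict_extensional)
  qed
qed


section \<open>Outer automorphisms and their action on conjugacy classes of subgroups\<close>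

definition conj_by :: "('a, 'b) monoid_scheme \<Rightarrow> 'a \<Rightarrow> 'a \<Rightarrow> 'a"
  where "conj_by G g = (\<lambda>h\<in>carrier G. g \<otimes>\<^bsub>G\<^esub> h \<otimes>\<^bsub>G\<^esub> inv\<^bsub>G\<^esub> g)"

definition Inn :: "('a, 'b) monoid_scheme \<Rightarrow> ('a \<Rightarrow> 'a) set"
  where "Inn G = conj_by G ` carrier G"

definition Out :: "('a, 'b) monoid_scheme \<Rightarrow> ('a \<Rightarrow> 'a) set monoid"
  where "Out G = AutoGroup G Mod Inn G"

definition conj_class :: "('a, 'b) monoid_scheme \<Rightarrow> 'a set \<Rightarrow> 'a set set"
  where "conj_class G U =
    orbit G (\<lambda>g. \<lambda>H\<in>{H. subgroup H G}. g <#\<^bsub>G\<^esub> H #>\<^bsub>G\<^esub> (inv\<^bsub>G\<^esub> g)) U"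

definition conj_classes :: "('a, 'b) monoid_scheme \<Rightarrow> 'a set set set"
  where "conj_classes G = {conj_class G U | U. subgroup U G}"

text \<open>An outer automorphism is a coset, and it is applied to a conjugacy class by applying all its
  representatives to all members of the class; see \<open>out_action_eq\<close> for the action on representatives.\<close>

definition out_action ::
    "('a, 'b) monoid_scheme \<Rightarrow> ('a \<Rightarrow> 'a) set \<Rightarrow> 'a set set \<Rightarrow> 'a set set"
  where "out_action G \<Phi> = (\<lambda>C\<in>conj_classes G. {\<phi> ` V | \<phi> V. \<phi> \<in> \<Phi> \<and> V \<in> C})"

lemma AutoGroup_simps [simp]:
  "carrier (AutoGroup G) = auto G"
  "\<phi> \<in> auto G \<Longrightarrow> \<psi> \<in> auto G \<Longrightarrow> \<phi> \<otimes>\<^bsub>AutoGroup G\<^esub> \<psi> = compose (carrier G) \<phi> \<psi>"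
  "\<one>\<^bsub>AutoGroup G\<^esub> = (\<lambda>x\<in>carrier G. x)"
  by (simp_all add: AutoGroup_def BijGroup_def auto_def)

context group
begin

lemma auto_closed: "\<phi> \<in> auto G \<Longrightarrow> x \<in> carrier G \<Longrightarrow> \<phi> x \<in> carrier G"
  by (auto simp: auto_def hom_def)

lemma auto_mult:
  "\<phi> \<in> auto G \<Longrightarrow> x \<in> carrier G \<Longrightarrow> y \<in> carrier G \<Longrightarrow> \<phi> (x \<otimes> y) = \<phi> x \<otimes> \<phi> y"
  by (auto simp: auto_def hom_def)

lemma auto_group_hom: "\<phi> \<in> auto G \<Longrightarrow> group_hom G G \<phi>"
  by unfold_locales (auto simp: auto_def)

lemma auto_inv: "\<phi> \<in> auto G \<Longrightarrow> x \<in> carrier G \<Longrightarrow> \<phi> (inv x) = inv (\<phi> x)"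
  by (simp add: group_hom.hom_inv[OF auto_group_hom])

lemma auto_subgroup: "\<phi> \<in> auto G \<Longrightarrow> subgroup U G \<Longrightarrow> subgroup (\<phi> ` U) G"
  by (simp add: group_hom.subgroup_img_is_subgroup[OF auto_group_hom])

lemma auto_ext: "\<phi> \<in> auto G \<Longrightarrow> \<phi> \<in> extensional (carrier G)"
  by (simp add: auto_def Bij_def)

lemma auto_mult_closed:
  "\<phi> \<in> auto G \<Longrightarrow> \<psi> \<in> auto G \<Longrightarrow> compose (carrier G) \<phi> \<psi> \<in> auto G"
  using group.is_monoid[OF AutoGroup] monoid.m_closed[of "AutoGroup G" \<phi> \<psi>] by simp

lemma conj_by_auto:
  assumes g: "g \<in> carrier G"
  shows "conj_by G g \<in> auto G"
proof -
  have "conj_by G g \<in> Bij (carrier G)"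
    using group_action.bij_prop0[OF action_by_conjugation g] by (simp add: conj_by_def)
  moreover have "conj_by G g \<in> hom G G"
  proof (rule homI)
    fix x y assume xy: "x \<in> carrier G" "y \<in> carrier G"
    have "g \<otimes> (x \<otimes> y) \<otimes> inv g = (g \<otimes> x \<otimes> inv g) \<otimes> (g \<otimes> y \<otimes> inv g)"
      using g xy by (simp add: m_assoc, simp flip: m_assoc)
    then show "conj_by G g (x \<otimes> y) = conj_by G g x \<otimes> conj_by G g y"
      using xy by (simp add: conj_by_def)
  qed (use g in \<open>auto simp: conj_by_def\<close>)
  ultimately show ?thesis
    by (simp add: auto_def)
qed

lemma conj_by_mult:
  assumes "g \<in> carrier G" "h \<in> carrier G" "x \<in> carrier G"
  shows "conj_by G g (conj_by G h x) = conj_by G (g \<otimes> h) x"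
  using assms by (simp add: conj_by_def inv_mult_group m_assoc)

lemma auto_conj_by:
  assumes "\<phi> \<in> auto G" "g \<in> carrier G" "x \<in> carrier G"
  shows "\<phi> (conj_by G g x) = conj_by G (\<phi> g) (\<phi> x)"
  using assms by (simp add: conj_by_def auto_mult auto_inv auto_closed)

lemma Inn_normal: "Inn G \<lhd> AutoGroup G"
proof -
  interpret A: group "AutoGroup G" by (rule AutoGroup)
  have hom: "group_hom G (AutoGroup G) (conj_by G)"
  proof unfold_locales
    show "conj_by G \<in> hom G (AutoGroup G)"
    proof (rule homI)
      fix g h assume gh: "g \<in> carrier G" "h \<in> carrier G"
      have "conj_by G (g \<otimes> h) = compose (carrier G) (conj_by G g) (conj_by G h)"
        using gh conj_by_mult[OF gh] 
        by (intro extensionalityI[of _ "carrier G"]) 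
          (auto simp: compose_def conj_by_auto auto_ext)
      then show "conj_by G (g \<otimes> h) = conj_by G g \<otimes>\<^bsub>AutoGroup G\<^esub> conj_by G h"
        using gh by (simp add: conj_by_auto)
    qed (simp add: conj_by_auto)
  qed
  have sub: "subgroup (Inn G) (AutoGroup G)"
    unfolding Inn_def by (rule group_hom.img_is_subgroup[OF hom])
  show ?thesis
  proof (rule A.normal_invI[OF sub])
    fix \<phi> \<iota> assume \<phi>: "\<phi> \<in> carrier (AutoGroup G)" and "\<iota> \<in> Inn G"
    then obtain g where g: "g \<in> carrier G" and \<iota>: "\<iota> = conj_by G g"
      by (auto simp: Inn_def)
    have \<phi>': "\<phi> \<in> auto G" using \<phi> by simp
    have gc: "conj_by G g \<in> carrier (AutoGroup G)" "conj_by G (\<phi> g) \<in> carrier (AutoGroup G)"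
      using g \<phi>' by (simp_all add: conj_by_auto auto_closed)
    have "compose (carrier G) \<phi> (conj_by G g) = compose (carrier G) (conj_by G (\<phi> g)) \<phi>"
      using g \<phi>' by (auto simp: compose_def auto_conj_by intro!: restrict_ext)
    then have "\<phi> \<otimes>\<^bsub>AutoGroup G\<^esub> conj_by G g = conj_by G (\<phi> g) \<otimes>\<^bsub>AutoGroup G\<^esub> \<phi>"
      using \<phi>' gc by simp
    then have "\<phi> \<otimes>\<^bsub>AutoGroup G\<^esub> \<iota> \<otimes>\<^bsub>AutoGroup G\<^esub> inv\<^bsub>AutoGroup G\<^esub> \<phi> = conj_by G (\<phi> g)"
      using A.inv_solve_right'[of _ _ \<phi>] gc \<phi> \<iota> by (metis A.inv_solve_right A.m_closed)
    then show "\<phi> \<otimes>\<^bsub>AutoGroup G\<^esub> \<iota> \<otimes>\<^bsub>AutoGroup G\<^esub> inv\<^bsub>AutoGroup G\<^esub> \<phi> \<in> Inn G"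
      using g \<phi>' by (simp add: Inn_def auto_closed)
  qed
qed

theorem group_Out: "group (Out G)"
  unfolding Out_def by (rule normal.factorgroup_is_group[OF Inn_normal])

lemma carrier_Out: "carrier (Out G) = {Inn G #>\<^bsub>AutoGroup G\<^esub> \<phi> | \<phi>. \<phi> \<in> auto G}"
  by (auto simp: Out_def FactGroup_def RCOSETS_def)

lemma mult_Out:
  assumes "\<phi> \<in> auto G" "\<psi> \<in> auto G"
  shows "(Inn G #>\<^bsub>AutoGroup G\<^esub> \<phi>) \<otimes>\<^bsub>Out G\<^esub> (Inn G #>\<^bsub>AutoGroup G\<^esub> \<psi>) =
    Inn G #>\<^bsub>AutoGroup G\<^esub> compose (carrier G) \<phi> \<psi>"
  using assms normal.rcos_sum[OF Inn_normal, of \<phi> \<psi>] by (simp add: Out_def FactGroup_def)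

lemma Out_coset_eq:
  assumes "\<phi> \<in> auto G"
  shows "Inn G #>\<^bsub>AutoGroup G\<^esub> \<phi> = {compose (carrier G) (conj_by G g) \<phi> | g. g \<in> carrier G}"
  using assms by (auto simp: r_coset_def Inn_def conj_by_auto)

lemma conj_class_eq:
  assumes "subgroup U G"
  shows "conj_class G U = {conj_by G g ` U | g. g \<in> carrier G}"
proof -
  have "g <# U #> inv g = conj_by G g ` U" if "g \<in> carrier G" for g
    using subgroup.subset[OF assms] that
    by (auto simp: l_coset_def r_coset_def conj_by_def image_iff subset_iff)
  then show ?thesis
    using assms unfolding conj_class_def orbit_def by auto
qed

theorem out_action_eq:
  assumes \<phi>: "\<phi> \<in> auto G" and U: "subgroup U G"
  shows "out_action G (Inn G #>\<^bsub>AutoGroup G\<^esub> \<phi>) (conj_class G U) = conj_class G (\<phi> ` U)"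
proof -
  have Uc: "U \<subseteq> carrier G" by (rule subgroup.subset[OF U])
  have img: "compose (carrier G) (conj_by G g) \<phi> ` conj_by G h ` U =
      conj_by G (g \<otimes> \<phi> h) ` \<phi> ` U" if g: "g \<in> carrier G" and h: "h \<in> carrier G" for g h
  proof -
    have "compose (carrier G) (conj_by G g) \<phi> (conj_by G h u) = conj_by G (g \<otimes> \<phi> h) (\<phi> u)"
      if "u \<in> U" for u
    proof -
      have u: "u \<in> carrier G"
        using that Uc by blast
      have "compose (carrier G) (conj_by G g) \<phi> (conj_by G h u) = conj_by G g (\<phi> (conj_by G h u))"
        using auto_closed[OF conj_by_auto[OF h] u] by (simp add: compose_def)
      then show ?thesis
        by (simp only: auto_conj_by[OF \<phi> h u] conj_by_mult[OF g auto_closed[OF \<phi> h] auto_closed[OF \<phi> u]])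
    qed
    then show ?thesis
      unfolding image_image by (rule image_cong[OF refl])
  qed
  have pairs: "{\<psi> ` V | \<psi> V. \<psi> \<in> {a g | g. g \<in> S} \<and> V \<in> {b h | h. h \<in> S}} =
      {a g ` b h | g h. g \<in> S \<and> h \<in> S}"
    for a :: "'a \<Rightarrow> 'a \<Rightarrow> 'a" and b :: "'a \<Rightarrow> 'a set" and S
    by blast
  have "out_action G (Inn G #>\<^bsub>AutoGroup G\<^esub> \<phi>) (conj_class G U) =
    {compose (carrier G) (conj_by G g) \<phi> ` conj_by G h ` U | g h. g \<in> carrier G \<and> h \<in> carrier G}"
  proof -
    have "conj_class G U \<in> conj_classes G"
      using U by (auto simp: conj_classes_def)
    then have "out_action G (Inn G #>\<^bsub>AutoGroup G\<^esub> \<phi>) (conj_class G U) =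
        {\<psi> ` V | \<psi> V. \<psi> \<in> Inn G #>\<^bsub>AutoGroup G\<^esub> \<phi> \<and> V \<in> conj_class G U}"
      by (simp add: out_action_def)
    then show ?thesis
      by (simp only: Out_coset_eq[OF \<phi>] conj_class_eq[OF U] pairs)
  qed
  also have "\<dots> = {conj_by G (g \<otimes> \<phi> h) ` \<phi> ` U | g h. g \<in> carrier G \<and> h \<in> carrier G}"
    by (intro Collect_cong iff_exI) (metis img)
  also have "\<dots> = {conj_by G g ` \<phi> ` U | g. g \<in> carrier G}"
  proof (intro equalityI subsetI)
    fix V assume "V \<in> {conj_by G g ` \<phi> ` U | g. g \<in> carrier G}"
    then obtain g where g: "g \<in> carrier G" "V = conj_by G g ` \<phi> ` U" by auto
    moreover have "g \<otimes> \<phi> \<one> = g"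
      using g group_hom.hom_one[OF auto_group_hom[OF \<phi>]] by simp
    ultimately show "V \<in> {conj_by G (g \<otimes> \<phi> h) ` \<phi> ` U | g h. g \<in> carrier G \<and> h \<in> carrier G}"
      using g by (intro CollectI exI[of _ g] exI[of _ \<one>]) simp
  qed (use auto_closed[OF \<phi>] m_closed in blast)
  finally show ?thesis
    using conj_class_eq[OF auto_subgroup[OF \<phi> U]] by simp
qed

theorem group_action_Out: "group_action (Out G) (conj_classes G) (out_action G)"
proof -
  interpret O: group "Out G" by (rule group_Out)
  have closed: "out_action G \<Phi> C \<in> conj_classes G"
    if "\<Phi> \<in> carrier (Out G)" "C \<in> conj_classes G" for \<Phi> C
    using that by (auto simp: carrier_Out conj_classes_def out_action_eq auto_subgroup)
  have comp: "out_action G (\<Phi> \<otimes>\<^bsub>Out G\<^esub> \<Psi>) C = out_action G \<Phi> (out_action G \<Psi> C)"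
    if mem: "\<Phi> \<in> carrier (Out G)" "\<Psi> \<in> carrier (Out G)" "C \<in> conj_classes G" for \<Phi> \<Psi> C
  proof -
    obtain \<phi> \<psi> U where *: "\<phi> \<in> auto G" "\<Phi> = Inn G #>\<^bsub>AutoGroup G\<^esub> \<phi>"
        "\<psi> \<in> auto G" "\<Psi> = Inn G #>\<^bsub>AutoGroup G\<^esub> \<psi>" "subgroup U G" "C = conj_class G U"
      using mem unfolding carrier_Out conj_classes_def by blast
    moreover have "compose (carrier G) \<phi> \<psi> ` U = \<phi> ` \<psi> ` U"
      unfolding image_image using subgroup.subset[OF \<open>subgroup U G\<close>]
      by (intro image_cong) (auto simp: compose_def)
    ultimately show ?thesis
      by (simp add: mult_Out out_action_eq auto_mult_closed auto_subgroup)
  qed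
  have one: "out_action G \<one>\<^bsub>Out G\<^esub> C = C" if mem: "C \<in> conj_classes G" for C
  proof -
    obtain U where U: "subgroup U G" "C = conj_class G U"
      using mem unfolding conj_classes_def by blast
    have "\<one>\<^bsub>Out G\<^esub> = Inn G #>\<^bsub>AutoGroup G\<^esub> (\<lambda>x\<in>carrier G. x)"
    proof -
      have "subgroup (Inn G) (AutoGroup G)" by (rule normal_imp_subgroup[OF Inn_normal])
      then have "Inn G #>\<^bsub>AutoGroup G\<^esub> \<one>\<^bsub>AutoGroup G\<^esub> = Inn G"
        using group.coset_mult_one[OF AutoGroup] subgroup.subset by blast
      then show ?thesis by (simp add: Out_def FactGroup_def)
    qed
    moreover have "(\<lambda>x\<in>carrier G. x) ` U = U"
      using subgroup.subset[OF U(1)] by (simp add: image_restrict_eq subset_iff cong: image_cong_simp)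
    ultimately show ?thesis
      using out_action_eq[OF id_in_auto U(1)] U(2) by simp
  qed
  have bij: "out_action G \<Phi> \<in> Bij (conj_classes G)" if \<Phi>: "\<Phi> \<in> carrier (Out G)" for \<Phi>
  proof -
    have "bij_betw (out_action G \<Phi>) (conj_classes G) (conj_classes G)"
      by (rule bij_betw_byWitness[where f' = "out_action G (inv\<^bsub>Out G\<^esub> \<Phi>)"])
        (use \<Phi> closed comp[symmetric] one in auto)
    then show ?thesis
      by (simp add: Bij_def out_action_def)
  qed
  interpret B: group "BijGroup (conj_classes G)" by (rule group_BijGroup)
  show ?thesis
  proof unfold_locales
    show "out_action G \<in> hom (Out G) (BijGroup (conj_classes G))"
    proof (rule homI)
      fix \<Phi> \<Psi> assume *: "\<Phi> \<in> carrier (Out G)" "\<Psi> \<in> carrier (Out G)"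
      have "out_action G (\<Phi> \<otimes>\<^bsub>Out G\<^esub> \<Psi>) =
          compose (conj_classes G) (out_action G \<Phi>) (out_action G \<Psi>)"
        using * comp bij[OF O.m_closed[OF *]]
        by (intro extensionalityI[of _ "conj_classes G"]) (auto simp: compose_def Bij_def)
      then show "out_action G (\<Phi> \<otimes>\<^bsub>Out G\<^esub> \<Psi>) =
          out_action G \<Phi> \<otimes>\<^bsub>BijGroup (conj_classes G)\<^esub> out_action G \<Psi>"
        using * bij by (simp add: BijGroup_def)
    qed (simp add: BijGroup_def bij)
  qed
qed

end


section \<open>The action on the abelianisation and the oriented outer automorphism group\<close>

text \<open>The vector of exponent sums identifies the abelianisation of the free group on a finite type
  of generators with a free abelian group: it is a surjective homomorphism whose kernel is the
  commutator subgroup.\<close>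

definition abelianise :: "('g::finite \<times> bool) list \<Rightarrow> int ^ 'g"
  where "abelianise w = (\<Sum>(x, b)\<leftarrow>w. axis x (if b then 1 else - 1))"

text \<open>The matrix of the endomorphism induced on the abelianisation; see \<open>abelianise_hom\<close>.\<close>

definition abel_matrix :: "(('g::finite \<times> bool) list \<Rightarrow> ('g \<times> bool) list) \<Rightarrow> int ^ 'g ^ 'g"
  where "abel_matrix \<phi> = (\<chi> i j. abelianise (\<phi> (gen j)) $ i)"

definition Out_plus_F2 :: "((2 \<times> bool) list \<Rightarrow> (2 \<times> bool) list) set monoid"
  where "Out_plus_F2 =
    (Out F2)\<lparr>carrier := {\<Phi> \<in> carrier (Out F2). \<forall>\<phi>\<in>\<Phi>. det (abel_matrix \<phi>) = 1}\<rparr>"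

lemma abelianise_simps [simp]:
  "abelianise [] = 0"
  "abelianise ((x, b) # w) = axis x (if b then 1 else - 1) + abelianise w"
  by (simp_all add: abelianise_def)

lemma axis_minus: "axis x (- c :: int) = - axis x c"
  by (simp add: axis_def vec_eq_iff)

lemma abelianise_push: "abelianise (push a w) = abelianise (a # w)"
  by (cases w; cases a) (auto simp: letter_inv_def axis_minus)

lemma abelianise_mult: "abelianise (u \<otimes>\<^bsub>free_group\<^esub> v) = abelianise u + abelianise v"
proof -
  have "abelianise (foldr push u v) = abelianise u + abelianise v"
  proof (induction u)
    case (Cons a u)
    then show ?case by (cases a) (simp add: abelianise_push)
  qed simp
  then show ?thesis by simp
qed

definition vec_group :: "(int ^ 'g) monoid"
  where "vec_group = \<lparr>carrier = UNIV, monoid.mult = (+), one = 0\<rparr>"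

lemma vec_group_simps [simp]:
  "carrier vec_group = UNIV" "u \<otimes>\<^bsub>vec_group\<^esub> v = u + v" "\<one>\<^bsub>vec_group\<^esub> = 0"
  by (simp_all add: vec_group_def)

lemma group_vec_group: "group vec_group"
proof (rule groupI)
  show "\<exists>v\<in>carrier vec_group. v \<otimes>\<^bsub>vec_group\<^esub> u = \<one>\<^bsub>vec_group\<^esub>"
    if "u \<in> carrier vec_group" for u :: "int ^ 'b"
    by (rule bexI[of _ "- u"]) simp_all
qed (simp_all add: add.assoc)

lemma abelianise_group_hom: "group_hom free_group vec_group abelianise"
proof -
  have "abelianise \<in> hom free_group vec_group"
    by (rule homI) (simp_all only: abelianise_mult vec_group_simps UNIV_I)
  then show ?thesis
    by (simp add: group_hom_def group_hom_axioms_def group_free_group group_vec_group)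
qed

lemma abelianise_inv:
  "w \<in> carrier free_group \<Longrightarrow> abelianise (inv\<^bsub>free_group\<^esub> w) = - abelianise w"
  by (metis abelianise_mult abelianise_simps(1) eq_neg_iff_add_eq_0 free_group_simps(3)
      group.l_inv group_free_group)

theorem abelianise_surj: "abelianise ` carrier free_group = UNIV"
proof -
  define R :: "(int ^ 'a) set" where "R = abelianise ` carrier free_group"
  have R: "subgroup R vec_group"
    unfolding R_def by (rule group_hom.img_is_subgroup[OF abelianise_group_hom])
  have add: "u + v \<in> R" if "u \<in> R" "v \<in> R" for u v
    using subgroup.m_closed[OF R that] by simp
  have zero: "0 \<in> R"
    using subgroup.one_closed[OF R] by simp
  have gens: "axis x c \<in> R" if "c = 1 \<or> c = - 1" for x and c :: int
    unfolding R_def using that by (intro image_eqI[of _ _ "[(x, c = 1)]"]) auto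
  have nat: "axis x (int n * c) \<in> R" if "c = 1 \<or> c = - 1" for x n and c :: int
  proof (induction n)
    case 0
    have "axis x (int 0 * c) = 0" by (simp add: axis_def vec_eq_iff)
    then show ?case using zero by metis
  next
    case (Suc n)
    have "axis x (int (Suc n) * c) = axis x c + axis x (int n * c)"
      by (simp add: axis_def vec_eq_iff algebra_simps)
    then show ?case using add[OF gens[OF that] Suc] by metis
  qed
  have ax: "axis x c \<in> R" for x and c :: int
    using nat[of 1 x "nat c"] nat[of "- 1" x "nat (- c)"] by (cases "c \<ge> 0") auto
  have sums: "(\<Sum>x\<in>A. axis x (v $ x)) \<in> R" if "finite A" for v :: "int ^ 'a" and A
    using that
  proof (induction A)
    case (insert x A)
    then show ?case using add[OF ax insert.IH] by simp
  qed (simp add: zero)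
  have "v \<in> R" for v
  proof -
    have "(\<Sum>x\<in>UNIV. axis x (v $ x)) = v"
      by (simp add: vec_eq_iff axis_def if_distrib cong: if_cong)
    then show ?thesis using sums[OF finite_class.finite_UNIV, of v] by simp
  qed
  then show ?thesis
    unfolding R_def by blast
qed

lemma hom_comm_group_eq_one:
  fixes Q (structure) and q :: "('g::finite \<times> bool) list \<Rightarrow> 'a"
  assumes "comm_group Q" and q: "q \<in> hom free_group Q"
    and w: "w \<in> carrier free_group" "abelianise w = 0"
  shows "q w = \<one>"
proof -
  interpret comm_group Q by fact
  have qc: "q (gen x) \<in> carrier Q" for x
    using hom_in_carrier[OF q, of "gen x"] by simp
  define z where "z v = finprod Q (\<lambda>x. q (gen x) [^] (v $ x)) UNIV" for v :: "int ^ 'g"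
  have zc: "z v \<in> carrier Q" for v
    unfolding z_def using qc by (intro finprod_closed) auto
  have z_add: "z (u + v) = z u \<otimes> z v" for u v
    unfolding z_def using qc by (subst finprod_multf[symmetric]) (auto simp: int_pow_mult)
  have "q w = (z \<circ> abelianise) w"
  proof (rule free_group_hom_eq[OF is_group q])
    show "z \<circ> abelianise \<in> hom free_group Q"
      by (rule homI) (simp_all only: o_def zc abelianise_mult z_add)
    show "q (gen x) = (z \<circ> abelianise) (gen x)" for x
    proof -
      have "z (axis x 1) = finprod Q (\<lambda>y. if x = y then q (gen y) else \<one>) UNIV"
        unfolding z_def using qc by (intro finprod_cong') (auto simp: axis_def int_pow_1)
      also have "\<dots> = q (gen x)"
        using qc by (intro finprod_singleton) auto
      finally show ?thesis by simp
    qed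
  qed (use w in simp)
  also have "\<dots> = z 0"
    using w by simp
  also have "z 0 = \<one>"
    unfolding z_def using finprod_one by simp
  finally show ?thesis .
qed

theorem abelianise_kernel:
  "{w \<in> carrier free_group. abelianise w = 0} =
    derived free_group (carrier (free_group :: ('g::finite \<times> bool) list monoid))"
proof (intro equalityI subsetI)
  let ?F = "free_group :: ('g \<times> bool) list monoid"
  let ?D = "derived ?F (carrier ?F)"
  interpret F: group ?F by (rule group_free_group)
  interpret A: group_hom ?F vec_group abelianise by (rule abelianise_group_hom)
  {
    fix w assume "w \<in> ?D"
    moreover have "?D \<subseteq> kernel ?F vec_group abelianise"
      unfolding derived_def
    proof (rule F.generate_subgroup_incl[OF _ A.subgroup_kernel])
      show "derived_set ?F (carrier ?F) \<subseteq> kernel ?F vec_group abelianise"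
      proof clarify
        fix u v assume uv: "u \<in> carrier ?F" "v \<in> carrier ?F"
        let ?c = "u \<otimes>\<^bsub>?F\<^esub> v \<otimes>\<^bsub>?F\<^esub> inv\<^bsub>?F\<^esub> u \<otimes>\<^bsub>?F\<^esub> inv\<^bsub>?F\<^esub> v"
        have "?c \<in> carrier ?F"
          using uv by (intro F.m_closed F.inv_closed)
        moreover have "abelianise ?c = 0"
          using uv by (simp only: abelianise_mult abelianise_inv) simp
        ultimately show "?c \<in> kernel ?F vec_group abelianise"
          by (simp only: kernel_def mem_Collect_eq vec_group_simps simp_thms)
      qed
    qed
    ultimately show "w \<in> {w \<in> carrier ?F. abelianise w = 0}"
      by (auto simp: kernel_def)
  next
    fix w assume w: "w \<in> {w \<in> carrier ?F. abelianise w = 0}"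
    let ?q = "\<lambda>w. ?D #>\<^bsub>?F\<^esub> w"
    interpret D: normal ?D ?F by (rule F.derived_self_is_normal)
    interpret Q: comm_group "?F Mod ?D" by (rule F.derived_quot_is_comm_group)
    have q: "?q \<in> hom ?F (?F Mod ?D)"
      by (rule D.r_coset_hom_Mod)
    have "?q w = \<one>\<^bsub>?F Mod ?D\<^esub>"
      using w by (intro hom_comm_group_eq_one[OF Q.comm_group_axioms q]) simp_all
    then have "?q w = ?D"
      by (simp add: FactGroup_def)
    moreover have "w \<in> ?q w"
      using w by (intro F.rcos_self D.subgroup_axioms) simp
    ultimately show "w \<in> ?D"
      by simp
  }
qed

theorem abelianise_hom:
  assumes \<phi>: "\<phi> \<in> hom free_group free_group" and w: "w \<in> carrier free_group"
  shows "abelianise (\<phi> w) = abel_matrix \<phi> *v abelianise w"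
proof -
  have "(abelianise \<circ> \<phi>) w = ((*v) (abel_matrix \<phi>) \<circ> abelianise) w"
  proof (rule free_group_hom_eq[OF group_vec_group])
    show "abelianise \<circ> \<phi> \<in> hom free_group vec_group"
      by (rule Group.hom_compose[OF \<phi> group_hom.homh[OF abelianise_group_hom]])
    show "(*v) (abel_matrix \<phi>) \<circ> abelianise \<in> hom free_group vec_group"
      by (rule homI) (simp_all only: o_def abelianise_mult vec_group_simps UNIV_I
          matrix_vector_right_distrib)
    show "(abelianise \<circ> \<phi>) (gen x) = ((*v) (abel_matrix \<phi>) \<circ> abelianise) (gen x)" for x
      by (simp add: vec_eq_iff abel_matrix_def matrix_vector_mult_def axis_def if_distrib
          cong: if_cong)
  qed (use w in simp)
  then show ?thesis by simp
qed

lemma auto_hom: "\<phi> \<in> auto G \<Longrightarrow> \<phi> \<in> hom G G"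
  by (simp add: auto_def)

lemma abel_matrix_compose:
  assumes \<phi>: "\<phi> \<in> auto free_group" and \<psi>: "\<psi> \<in> auto free_group"
  shows "abel_matrix (compose (carrier free_group) \<phi> \<psi>) = abel_matrix \<phi> ** abel_matrix \<psi>"
proof -
  have "\<psi> (gen j) \<in> carrier free_group" for j
    by (rule group.auto_closed[OF group_free_group \<psi>]) simp
  then have "abelianise (compose (carrier free_group) \<phi> \<psi> (gen j)) =
      abel_matrix \<phi> *v abelianise (\<psi> (gen j))" for j
    using abelianise_hom[OF auto_hom[OF \<phi>]] by (simp add: compose_def)
  then show ?thesis
    by (simp add: vec_eq_iff abel_matrix_def matrix_matrix_mult_def matrix_vector_mult_def)
qed

lemma abel_matrix_id: "abel_matrix (\<lambda>w\<in>carrier free_group. w) = mat 1"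
  by (simp add: abel_matrix_def mat_def axis_def vec_eq_iff)

lemma abel_matrix_conj_by:
  assumes g: "g \<in> carrier free_group"
  shows "abel_matrix (conj_by free_group g) = mat 1"
proof -
  have "abelianise (conj_by free_group g (gen j)) = abelianise (gen j)" for j
  proof -
    have "conj_by free_group g (gen j) =
        g \<otimes>\<^bsub>free_group\<^esub> gen j \<otimes>\<^bsub>free_group\<^esub> inv\<^bsub>free_group\<^esub> g"
      by (simp add: conj_by_def)
    then show ?thesis
      by (simp only: abelianise_mult abelianise_inv[OF g]) (simp add: algebra_simps del: abelianise_simps)
  qed
  then show ?thesis
    by (simp add: abel_matrix_def mat_def axis_def vec_eq_iff)
qed

theorem Out_plus_F2_iff:
  assumes \<phi>: "\<phi> \<in> auto F2"
  shows "Inn F2 #>\<^bsub>AutoGroup F2\<^esub> \<phi> \<in> carrier Out_plus_F2 \<longleftrightarrow> det (abel_matrix \<phi>) = 1"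
proof -
  interpret F: group F2 by (rule group_free_group)
  have "abel_matrix \<psi> = abel_matrix \<phi>" if \<psi>: "\<psi> \<in> Inn F2 #>\<^bsub>AutoGroup F2\<^esub> \<phi>" for \<psi>
  proof -
    obtain g where g: "g \<in> carrier F2" "\<psi> = compose (carrier F2) (conj_by F2 g) \<phi>"
      using \<psi> unfolding F.Out_coset_eq[OF \<phi>] by blast
    show ?thesis
      unfolding g(2) abel_matrix_compose[OF F.conj_by_auto[OF g(1)] \<phi>] abel_matrix_conj_by[OF g(1)]
      by simp
  qed
  moreover have "\<phi> \<in> Inn F2 #>\<^bsub>AutoGroup F2\<^esub> \<phi>"
    using group.rcos_self[OF F.AutoGroup, of \<phi> "Inn F2"] \<phi> normal_imp_subgroup[OF F.Inn_normal]
    by simp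
  moreover have "Inn F2 #>\<^bsub>AutoGroup F2\<^esub> \<phi> \<in> carrier (Out F2)"
    using \<phi> unfolding F.carrier_Out by blast
  moreover have "\<Phi> \<in> carrier Out_plus_F2 \<longleftrightarrow>
      \<Phi> \<in> carrier (Out F2) \<and> (\<forall>\<psi>\<in>\<Phi>. det (abel_matrix \<psi>) = 1)" for \<Phi>
    by (simp add: Out_plus_F2_def)
  ultimately show ?thesis
    by metis
qed

theorem subgroup_Out_plus_F2: "subgroup (carrier Out_plus_F2) (Out F2)"
proof -
  interpret F: group F2 by (rule group_free_group)
  interpret O: group "Out F2" by (rule F.group_Out)
  let ?c = "\<lambda>\<phi>. Inn F2 #>\<^bsub>AutoGroup F2\<^esub> \<phi>"
  have sub: "carrier Out_plus_F2 \<subseteq> carrier (Out F2)"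
    by (auto simp: Out_plus_F2_def)
  have rep: "\<exists>\<phi>\<in>auto F2. \<Phi> = ?c \<phi>" if "\<Phi> \<in> carrier (Out F2)" for \<Phi>
    using that unfolding F.carrier_Out by blast
  have one: "\<one>\<^bsub>Out F2\<^esub> = ?c (\<lambda>w\<in>carrier F2. w)"
  proof -
    have "?c \<one>\<^bsub>AutoGroup F2\<^esub> = Inn F2"
      using group.coset_mult_one[OF F.AutoGroup] subgroup.subset
        normal_imp_subgroup[OF F.Inn_normal] by blast
    then show ?thesis by (simp add: Out_def FactGroup_def)
  qed
  have one_mem: "\<one>\<^bsub>Out F2\<^esub> \<in> carrier Out_plus_F2"
    unfolding one Out_plus_F2_iff[OF F.id_in_auto] abel_matrix_id by simp
  have mult: "?c \<phi> \<otimes>\<^bsub>Out F2\<^esub> ?c \<psi> \<in> carrier Out_plus_F2 \<longleftrightarrow>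
      det (abel_matrix \<phi>) * det (abel_matrix \<psi>) = 1" if "\<phi> \<in> auto F2" "\<psi> \<in> auto F2" for \<phi> \<psi>
    unfolding F.mult_Out[OF that] Out_plus_F2_iff[OF F.auto_mult_closed[OF that]]
      abel_matrix_compose[OF that] det_mul by (rule refl)
  show ?thesis
  proof (rule O.subgroupI[OF sub])
    show "carrier Out_plus_F2 \<noteq> {}"
      using one_mem by blast
    fix \<Phi> assume \<Phi>: "\<Phi> \<in> carrier Out_plus_F2"
    then obtain \<phi> where \<phi>: "\<phi> \<in> auto F2" "\<Phi> = ?c \<phi>"
      using rep sub by blast
    have det: "det (abel_matrix \<phi>) = 1"
      using \<Phi> Out_plus_F2_iff[OF \<phi>(1)] \<phi>(2) by simp
    show "inv\<^bsub>Out F2\<^esub> \<Phi> \<in> carrier Out_plus_F2"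
    proof -
      have "\<Phi> \<in> carrier (Out F2)" using \<Phi> sub by blast
      then obtain \<psi> where \<psi>: "\<psi> \<in> auto F2" "inv\<^bsub>Out F2\<^esub> \<Phi> = ?c \<psi>"
        using rep O.inv_closed by blast
      have "?c \<phi> \<otimes>\<^bsub>Out F2\<^esub> ?c \<psi> \<in> carrier Out_plus_F2"
        using one_mem O.r_inv[OF \<open>\<Phi> \<in> carrier (Out F2)\<close>] \<phi>(2) \<psi>(2) by simp
      then show ?thesis
        unfolding mult[OF \<phi>(1) \<psi>(1)] \<psi>(2) Out_plus_F2_iff[OF \<psi>(1)] det by simp
    qed
    fix \<Psi> assume \<Psi>: "\<Psi> \<in> carrier Out_plus_F2"
    then obtain \<psi> where \<psi>: "\<psi> \<in> auto F2" "\<Psi> = ?c \<psi>"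
      using rep sub by blast
    have "det (abel_matrix \<psi>) = 1"
      using \<Psi> Out_plus_F2_iff[OF \<psi>(1)] \<psi>(2) by simp
    then show "\<Phi> \<otimes>\<^bsub>Out F2\<^esub> \<Psi> \<in> carrier Out_plus_F2"
      unfolding \<phi>(2) \<psi>(2) mult[OF \<phi>(1) \<psi>(1)] det by simp
  qed
qed

end

theory Submission
  imports Defs
begin

text \<open>The free group \<open>F\<close> on two generators is the fundamental group of the punctured torus, and the plane
  punctured at the lattice points is the covering that belongs to the commutator subgroup \<open>F'\<close>.
  The winding numbers of a closed word around the punctures make the abelianisation of \<open>F'\<close> the group
  of finitely supported functions on \<open>\<int>\<^sup>2\<close>. Conjugation by \<open>g\<close> translates these functions by the
  exponent vector of \<open>g\<close>. An automorphism with a matrix \<open>A\<close> of determinant \<open>1\<close> moves them by an affine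
  map \<open>x \<mapsto> A x + c\<close>, since it carries the commutator of the generators, whose winding function is
  the indicator of one point, to a word of the same kind (\<open>auto_wind\<close>). Hence, if \<open>U\<close> consists of the
  closed words with winding function in an additive group \<open>M\<close>, the class of \<open>U\<close> is fixed by an outer
  automorphism with matrix \<open>A\<close> if and only if \<open>A\<close> carries \<open>M\<close> to a translate of \<open>M\<close>.

  For a group \<open>H\<close> of such matrices, let \<open>M\<close> be spanned by the indicator of the origin and the doubles
  of the functions \<open>marking A\<close> with \<open>A \<in> H\<close>, where \<open>marking A\<close> is the sum of the indicators of
  \<open>A (1, 0)\<close> and \<open>2 A (1, 2)\<close>. Away from the origin all values in \<open>M\<close> are even, so the origin is the
  only point whose indicator belongs to \<open>M\<close>, and no translation can be involved. The matrices \<open>A\<close> of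
  determinant \<open>1\<close> are the edges of a graph in which \<open>A\<close> joins \<open>A (1, 0)\<close> to \<open>2 A (1, 2)\<close>. This
  graph is a forest: in a finite set of edges, an end with the longest vector \<open>A (1, 0)\<close> or \<open>A (1, 2)\<close>
  lies on one edge only. Therefore the markings are linearly independent (\<open>markings_independent\<close>), and
  \<open>2 marking A \<in> M\<close> forces \<open>A \<in> H\<close>.

  So the stabiliser of the class of \<open>U\<close> consists of the outer automorphisms with matrix in \<open>H\<close>, and it
  remains to see that the matrix determines the outer automorphism. This is a theorem of Nielsen
  (\<open>auto_inner_if_abel_matrix_trivial\<close>). By Nielsen reduction every generating pair arises from the
  standard generators by elementary moves (\<open>generating_pair_nielsen\<close>). These moves never leave the class
  of pairs that are, up to exchange, inversion of entries and simultaneous conjugation, built by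
  concatenation from two letters (\<open>nielsen_coherent\<close>), and a word in two fixed letters whose exponent
  vector is that of a single letter is a single letter. Nielsen moves also give the winding function of the
  commutator of a generating pair.\<close>

text \<open>Products are kept in group notation, so that the group axioms apply to them as rewrite rules.\<close>

declare free_group_simps(2) [simp del]

section \<open>Nielsen equivalence of pairs in a group\<close>

context group
begin

lemma mult_inv_cancel:
  assumes "x \<in> carrier G" "y \<in> carrier G"
  shows "x \<otimes> (inv x \<otimes> y) = y" "inv x \<otimes> (x \<otimes> y) = y"
  using assms by (simp_all flip: m_assoc)

text \<open>As rewrite rules, these bring every product of elements and inverses to its freely reduced,
  right-bracketed form and so decide identities that hold in all groups.\<close>

lemmas group_word_simps = m_assoc inv_mult_group mult_inv_cancel

text \<open>Simultaneous conjugation is included as a move because it shortens the one kind of pair that is minimal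
  for the other moves without being Nielsen reduced; see \<open>minimal_pair_no_half_overlaps\<close>.\<close>

inductive nielsen :: "'a \<Rightarrow> 'a \<Rightarrow> 'a \<Rightarrow> 'a \<Rightarrow> bool" for x y
  where
    nielsen_refl: "nielsen x y x y"
  | nielsen_swap: "nielsen x y u v \<Longrightarrow> nielsen x y v u"
  | nielsen_inv: "nielsen x y u v \<Longrightarrow> nielsen x y (inv u) v"
  | nielsen_mult: "nielsen x y u v \<Longrightarrow> nielsen x y (u \<otimes> v) v"
  | nielsen_conj: "nielsen x y u v \<Longrightarrow> g \<in> carrier G \<Longrightarrow> nielsen x y (g \<otimes> u \<otimes> inv g) (g \<otimes> v \<otimes> inv g)"

lemma nielsen_closed:
  assumes "nielsen x y u v" "x \<in> carrier G" "y \<in> carrier G"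
  shows "u \<in> carrier G" "v \<in> carrier G"
  using assms by (induction) auto

lemma nielsen_trans:
  assumes "nielsen u v p q" "nielsen x y u v"
  shows "nielsen x y p q"
  using assms by induction (auto intro: nielsen.intros)

lemma nielsen_inv2: "nielsen x y u v \<Longrightarrow> nielsen x y u (inv v)"
  by (intro nielsen_swap[of _ _ "inv v" u] nielsen_inv nielsen_swap[of _ _ u v])

lemma nielsen_mult_inv:
  assumes "nielsen x y u v" "v \<in> carrier G"
  shows "nielsen x y (u \<otimes> inv v) v"
  using nielsen_inv2[OF nielsen_mult[OF nielsen_inv2[OF assms(1)]]] assms(2) by simp

lemma nielsen_sym:
  assumes "nielsen x y u v" "x \<in> carrier G" "y \<in> carrier G"
  shows "nielsen u v x y"
  using assms
proof induction
  case (nielsen_swap u v)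
  then show ?case
    using nielsen_trans[OF _ nielsen.nielsen_swap[OF nielsen_refl]] by blast
next
  case (nielsen_inv u v)
  have "u \<in> carrier G" "v \<in> carrier G"
    using nielsen_closed nielsen_inv by blast+
  then have "nielsen (inv u) v u v"
    using nielsen.nielsen_inv[OF nielsen_refl, of "inv u" v] by simp
  then show ?case
    using nielsen_trans nielsen_inv by blast
next
  case (nielsen_mult u v)
  have uv: "u \<in> carrier G" "v \<in> carrier G"
    using nielsen_closed nielsen_mult by blast+
  then have "nielsen (u \<otimes> v) v u v"
    using nielsen_mult_inv[OF nielsen_refl, of v "u \<otimes> v"] by (simp add: group_word_simps)
  then show ?case
    using nielsen_trans nielsen_mult by blast
next
  case (nielsen_conj u v g)
  have uv: "u \<in> carrier G" "v \<in> carrier G"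
    using nielsen_closed nielsen_conj by blast+
  have "inv g \<otimes> (g \<otimes> w \<otimes> inv g) \<otimes> inv (inv g) = w" if "w \<in> carrier G" for w
    using that nielsen_conj.hyps(2) by (simp add: group_word_simps)
  note cancel = this[OF uv(1)] this[OF uv(2)]
  have "nielsen (g \<otimes> u \<otimes> inv g) (g \<otimes> v \<otimes> inv g) u v"
    using nielsen.nielsen_conj[OF nielsen_refl inv_closed[OF nielsen_conj.hyps(2)],
        of "g \<otimes> u \<otimes> inv g" "g \<otimes> v \<otimes> inv g"]
    by (simp only: cancel)
  then show ?case
    using nielsen_trans nielsen_conj by blast
qed (rule nielsen_refl)

lemma subgroup_conj_preimage:
  assumes "subgroup S G" "g \<in> carrier G"
  shows "subgroup {h \<in> carrier G. g \<otimes> h \<otimes> inv g \<in> S} G"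
proof (rule subgroupI)
  show "{h \<in> carrier G. g \<otimes> h \<otimes> inv g \<in> S} \<noteq> {}"
    using assms subgroup.one_closed[OF assms(1)] by (auto intro!: exI[of _ \<one>])
next
  fix h assume "h \<in> {h \<in> carrier G. g \<otimes> h \<otimes> inv g \<in> S}"
  moreover from this have "inv (g \<otimes> h \<otimes> inv g) = g \<otimes> inv h \<otimes> inv g"
    using assms(2) by (simp add: group_word_simps)
  ultimately show "inv h \<in> {h \<in> carrier G. g \<otimes> h \<otimes> inv g \<in> S}"
    using subgroup.m_inv_closed[OF assms(1), of "g \<otimes> h \<otimes> inv g"] by simp
next
  fix h k assume "h \<in> {h \<in> carrier G. g \<otimes> h \<otimes> inv g \<in> S}" "k \<in> {h \<in> carrier G. g \<otimes> h \<otimes> inv g \<in> S}"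
  moreover from this have "(g \<otimes> h \<otimes> inv g) \<otimes> (g \<otimes> k \<otimes> inv g) = g \<otimes> (h \<otimes> k) \<otimes> inv g"
    using assms(2) by (simp add: group_word_simps)
  ultimately show "h \<otimes> k \<in> {h \<in> carrier G. g \<otimes> h \<otimes> inv g \<in> S}"
    using subgroup.m_closed[OF assms(1), of "g \<otimes> h \<otimes> inv g" "g \<otimes> k \<otimes> inv g"] by simp
qed auto

lemma nielsen_generate:
  assumes "nielsen x y u v" "x \<in> carrier G" "y \<in> carrier G" "generate G {x, y} = carrier G"
  shows "generate G {u, v} = carrier G"
  using assms
proof induction
  case (nielsen_swap u v)
  then show ?case by (simp add: insert_commute)
next
  case (nielsen_inv u v)
  have uv: "u \<in> carrier G" "v \<in> carrier G"
    using nielsen_closed nielsen_inv by blast+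
  then have S: "subgroup (generate G {inv u, v}) G"
    by (intro generate_is_subgroup) auto
  have "inv (inv u) \<in> generate G {inv u, v}"
    by (intro generate.inv) simp
  then have "{u, v} \<subseteq> generate G {inv u, v}"
    using uv by (auto intro: generate.incl)
  then show ?case
    using generate_subgroup_incl[OF _ S] nielsen_inv subgroup.subset[OF S] by blast
next
  case (nielsen_mult u v)
  have uv: "u \<in> carrier G" "v \<in> carrier G"
    using nielsen_closed nielsen_mult by blast+
  then have S: "subgroup (generate G {u \<otimes> v, v}) G"
    by (intro generate_is_subgroup) auto
  have "(u \<otimes> v) \<otimes> inv v \<in> generate G {u \<otimes> v, v}"
    by (intro generate.inv generate.eng generate.incl) auto
  then have "{u, v} \<subseteq> generate G {u \<otimes> v, v}"
    using uv by (auto intro: generate.incl simp: group_word_simps)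
  then show ?case
    using generate_subgroup_incl[OF _ S] nielsen_mult subgroup.subset[OF S] by blast
next
  case (nielsen_conj u v g)
  let ?T = "generate G {g \<otimes> u \<otimes> inv g, g \<otimes> v \<otimes> inv g}"
  let ?S = "{h \<in> carrier G. g \<otimes> h \<otimes> inv g \<in> ?T}"
  have uv: "u \<in> carrier G" "v \<in> carrier G"
    using nielsen_closed nielsen_conj by blast+
  then have T: "subgroup ?T G"
    using nielsen_conj by (intro generate_is_subgroup) auto
  have S: "subgroup ?S G"
    by (rule subgroup_conj_preimage[OF T nielsen_conj.hyps(2)])
  have "{u, v} \<subseteq> ?S"
    using uv by (auto intro: generate.incl)
  then have S_all: "?S = carrier G"
    using generate_subgroup_incl[OF _ S] nielsen_conj subgroup.subset[OF S] by blast
  have "k \<in> ?T" if k: "k \<in> carrier G" for k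
  proof -
    have "inv g \<otimes> k \<otimes> g \<in> ?S"
      using k nielsen_conj.hyps S_all by simp
    then show ?thesis
      using k nielsen_conj.hyps by (simp add: group_word_simps)
  qed
  then show ?case
    using subgroup.subset[OF T] by blast
qed simp

end

section \<open>Cancellation in free groups\<close>

interpretation free: group "free_group :: ('g \<times> bool) list monoid"
  by (rule group_free_group)

abbreviation free_mult_op :: "('g \<times> bool) list \<Rightarrow> ('g \<times> bool) list \<Rightarrow> ('g \<times> bool) list" (infixl \<open>\<star>\<close> 70)
  where "u \<star> v \<equiv> u \<otimes>\<^bsub>free_group\<^esub> v"

abbreviation free_inv_op :: "('g \<times> bool) list \<Rightarrow> ('g \<times> bool) list" (\<open>_\<^sup>-\<close> [1000] 1000)
  where "u\<^sup>- \<equiv> inv\<^bsub>free_group\<^esub> u"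

definition word_inv :: "('g \<times> bool) list \<Rightarrow> ('g \<times> bool) list"
  where "word_inv w = rev (map letter_inv w)"

lemma word_inv_simps [simp]:
  "word_inv [] = []" "word_inv (word_inv w) = w" "length (word_inv w) = length w"
  "word_inv w = [] \<longleftrightarrow> w = []"
  by (simp_all add: word_inv_def rev_map o_def)

lemma word_inv_Cons: "word_inv (a # w) = word_inv w @ [letter_inv a]"
  by (simp add: word_inv_def)

lemma reduced_append_iff:
  "reduced (u @ v) \<longleftrightarrow> reduced u \<and> reduced v \<and> (u \<noteq> [] \<longrightarrow> v \<noteq> [] \<longrightarrow> hd v \<noteq> letter_inv (last u))"
  by (auto simp: reduced_def successively_append_iff)

lemma reduced_word_inv: "reduced w \<Longrightarrow> reduced (word_inv w)"
proof (induction w)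
  case (Cons a w)
  then show ?case
    using reduced_tl[of a w]
    by (cases w) (auto simp: word_inv_Cons reduced_append_iff)
qed simp

lemma reduced_drop: "reduced w \<Longrightarrow> reduced (drop n w)"
  by (metis append_take_drop_id reduced_append_iff)

lemma free_mult: "u \<star> v = foldr push u v"
  by (simp add: free_group_simps)

lemma free_one: "\<one>\<^bsub>free_group\<^esub> = []"
  by (simp add: free_group_simps)

lemma reduced_mult: "reduced v \<Longrightarrow> reduced (u \<star> v)"
  by (simp add: free_mult reduced_foldr_push)

lemma mult_append: "reduced (u @ v) \<Longrightarrow> u \<star> v = u @ v"
proof (induction u)
  case (Cons a u)
  then have "push a (u @ v) = a # u @ v"
    by (intro push_reduced) simp
  moreover have "reduced (u @ v)"
    using Cons.prems reduced_tl by fastforce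
  ultimately show ?case
    using Cons.IH by (simp add: free_mult)
qed (simp add: free_mult)

lemma mult_Nil [simp]: "reduced w \<Longrightarrow> w \<star> [] = w" "[] \<star> w = w"
  using free.r_one[of w] by (simp_all add: free_mult)

lemma inv_eq_word_inv: "reduced w \<Longrightarrow> w\<^sup>- = word_inv w"
proof (rule free.inv_equality)
  assume w: "reduced w"
  have "foldr push (word_inv w) w = foldr push (word_inv w) (foldr push w [])"
    using w by (simp add: foldr_push_Nil)
  then show "word_inv w \<star> w = \<one>\<^bsub>free_group\<^esub>"
    by (simp add: free_mult free_one foldr_push_inverse word_inv_def)
qed (simp_all add: reduced_word_inv)

lemma free_inv_closed [simp]: "reduced w \<Longrightarrow> reduced (w\<^sup>-)"
  using free.inv_closed[of w] by simp

lemma free_mult_closed [simp]: "reduced u \<Longrightarrow> reduced v \<Longrightarrow> reduced (u \<star> v)"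
  using free.m_closed[of u v] by simp

lemmas free_word_simps = free.group_word_simps[unfolded free_group_simps(1) mem_Collect_eq]

lemma mult_length: "length (u \<star> v) \<le> length u + length v"
proof (induction u)
  case (Cons a u)
  have "length (push a w) \<le> Suc (length w)" for w :: "('a \<times> bool) list"
    by (cases w) auto
  then have "length (foldr push (a # u) v) \<le> Suc (length (foldr push u v))"
    by simp
  also have "\<dots> \<le> Suc (length u + length v)"
    using Cons by (simp add: free_mult)
  finally show ?case by (simp add: free_mult)
qed (simp add: free_mult)

fun overlap :: "'a list \<Rightarrow> 'a list \<Rightarrow> nat"
  where
    "overlap (a # u) (b # v) = (if a = b then Suc (overlap u v) else 0)"
  | "overlap [] v = 0"
  | "overlap u [] = 0"

lemma overlap_Nil: "overlap u [] = 0"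
  by (cases u) auto

lemma overlap_le: "overlap u v \<le> length u" "overlap u v \<le> length v"
  by (induction u v rule: overlap.induct) auto

lemma overlap_self: "overlap u u = length u"
  by (induction u) auto

lemma overlap_sym: "overlap u v = overlap v u"
  by (induction u v rule: overlap.induct) (auto simp: overlap_Nil)

lemma take_overlap: "k \<le> overlap u v \<Longrightarrow> take k u = take k v"
proof (induction u v arbitrary: k rule: overlap.induct)
  case (1 a u b v)
  then show ?case by (cases k) (auto split: if_splits)
qed auto

lemma overlap_take_append:
  "overlap u v < n \<Longrightarrow> n \<le> length v \<Longrightarrow> overlap u (take n v @ r) = overlap u v"
proof (induction u v arbitrary: n rule: overlap.induct)
  case (1 a u b v)
  then show ?case by (cases n) auto
qed (auto simp: neq_Nil_conv)

text \<open>All cancellation in \<open>u\<^sup>-v\<close> takes place in the longest common prefix of \<open>u\<close> and \<open>v\<close>, so that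
  cancellation can be discussed in terms of prefixes only.\<close>

lemma mult_overlap:
  assumes "reduced u" "reduced v"
  shows "word_inv u \<star> v = word_inv (drop (overlap u v) u) @ drop (overlap u v) v"
  using assms
proof (induction u v rule: overlap.induct)
  case (1 a u b v)
  show ?case
  proof (cases "a = b")
    case True
    have "push (letter_inv a) (a # v) = v"
      by simp
    then show ?thesis
      using 1(1) True 1(2,3) reduced_tl[of a u] reduced_tl[of b v] by (simp add: free_mult word_inv_Cons)
  next
    case False
    then have "reduced (word_inv (a # u) @ b # v)"
      using 1 reduced_word_inv[of "a # u"] by (simp add: reduced_append_iff word_inv_Cons)
    then show ?thesis
      using False by (simp add: mult_append)
  qed
next
  case (2 v)
  then show ?case by (simp add: free_mult)
next
  case (3 a u)
  then show ?case
    using mult_append[of "word_inv (a # u)" "[]"] reduced_word_inv[of "a # u"] by simp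
qed

lemma length_mult_overlap:
  assumes "reduced u" "reduced v"
  shows "length (word_inv u \<star> v) + 2 * overlap u v = length u + length v"
  using overlap_le[of u v] by (simp add: mult_overlap[OF assms])

text \<open>A common prefix of \<open>u\<close> and its inverse that reaches the middle of \<open>u\<close> would show a letter equal to
  its own inverse or a pair of adjacent letters that cancel.\<close>

lemma overlap_inverse:
  assumes "reduced u" "u \<noteq> []"
  shows "2 * overlap (word_inv u) u < length u"
proof (rule ccontr)
  assume *: "\<not> ?thesis"
  define n where "n = length u"
  define k where "k = (n - 1) div 2"
  have n: "n > 0"
    using assms by (simp add: n_def)
  have k2: "2 * k \<le> n - 1"
    by (simp add: k_def)
  have k: "k < n" "k < overlap (word_inv u) u"
    using n * k2 unfolding n_def by linarith+
  have "word_inv u ! k = u ! k"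
    using take_overlap[of "Suc k" "word_inv u" u] k n_def by (metis Suc_leI lessI nth_take)
  moreover have "word_inv u ! k = letter_inv (u ! (n - 1 - k))"
    using k by (simp add: word_inv_def rev_nth n_def)
  ultimately have eq: "u ! k = letter_inv (u ! (n - 1 - k))"
    by simp
  show False
  proof (cases "even n")
    case True
    then obtain b where "n = 2 * Suc b"
      using n by (metis evenE gr0_conv_Suc mult_0_right nat_0_less_mult_iff)
    then have "n - 1 - k = Suc k" "Suc k < n"
      by (simp_all add: k_def)
    then have "u ! Suc k = letter_inv (u ! k)" 
      using eq by simp
    moreover have "drop k u = u ! k # u ! Suc k # drop (Suc (Suc k)) u"
      using \<open>Suc k < n\<close> by (simp add: Cons_nth_drop_Suc n_def)
    ultimately show False
      using reduced_drop[OF assms(1), of k] by simp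
  next
    case False
    then have "n - 1 - k = k"
      by (auto simp: k_def elim!: oddE)
    then show False using eq by simp
  qed
qed

section \<open>Nielsen reduced sets\<close>

text \<open>In a product \<open>x y z\<close> of elements of \<open>S\<close>, the letters of \<open>y\<close> that cancel against \<open>x\<close> are a common
  prefix of \<open>x\<^sup>-\<close> and \<open>y\<close>, and those that cancel against \<open>z\<close> are the inverse of a common prefix of
  \<open>z\<close> and \<open>y\<^sup>-\<close>. The condition says that some letter of \<open>y\<close> survives.\<close>

definition nielsen_reduced :: "('g \<times> bool) list set \<Rightarrow> bool"
  where "nielsen_reduced S \<longleftrightarrow> (\<forall>y\<in>S. reduced y \<and> y \<noteq> [] \<and> word_inv y \<in> S \<and>
    (\<forall>p\<in>S - {y}. \<forall>q\<in>S - {word_inv y}. overlap p y + overlap q (word_inv y) < length y))"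

abbreviation word_prod :: "('g \<times> bool) list list \<Rightarrow> ('g \<times> bool) list"
  where "word_prod ys \<equiv> foldr (\<star>) ys []"

lemma nielsen_reduced_inv_neq:
  assumes "nielsen_reduced S" "y \<in> S"
  shows "word_inv y \<noteq> y"
proof
  assume "word_inv y = y"
  moreover have "reduced y" "y \<noteq> []"
    using assms by (auto simp: nielsen_reduced_def)
  ultimately show False
    using overlap_inverse[of y] overlap_self[of y] by simp
qed

text \<open>The induction adds factors on the left. Here \<open>k\<close> is the number of letters of the first factor \<open>y\<close>
  that were cancelled by the second; the bound on \<open>overlap p y + k\<close> guarantees that a further factor
  stops inside the surviving part of \<open>y\<close>, so each factor contributes a letter of its own.\<close>

lemma nielsen_reduced_prod:
  assumes S: "nielsen_reduced S"
  shows "set (y # zs) \<subseteq> S \<Longrightarrow> successively (\<lambda>x y. y \<noteq> word_inv x) (y # zs) \<Longrightarrow>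
    \<exists>k r. word_prod (y # zs) = take (length y - k) y @ r \<and> length zs \<le> length r \<and>
      (\<forall>p\<in>S - {y}. overlap p y + k < length y) \<and> reduced (word_prod (y # zs)) \<and> k < length y"
proof (induction zs arbitrary: y)
  case Nil
  then have y: "y \<in> S" "reduced y" "y \<noteq> []" "word_inv y \<in> S"
    using S by (auto simp: nielsen_reduced_def)
  have "y \<noteq> word_inv y"
    using nielsen_reduced_inv_neq[OF S y(1)] by simp
  then have "overlap p y + overlap y (word_inv y) < length y" if "p \<in> S - {y}" for p
    using S y(1) that by (simp add: nielsen_reduced_def)
  then have "overlap p y < length y" if "p \<in> S - {y}" for p
    using that add_lessD1 by blast
  moreover have "word_prod [y] = y"
    using y by simp
  ultimately show ?case
    using y by (intro exI[of _ 0] exI[of _ "[]"]) auto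
next
  case (Cons z zs)
  from Cons.prems have yz: "y \<in> S" "z \<in> S" "z \<noteq> word_inv y" "set (z # zs) \<subseteq> S"
      "successively (\<lambda>x y. y \<noteq> word_inv x) (z # zs)"
    by auto
  have red: "reduced y" "reduced z" "word_inv y \<in> S" 
    using S yz by (auto simp: nielsen_reduced_def)
  obtain k r where kr: "word_prod (z # zs) = take (length z - k) z @ r" "length zs \<le> length r"
      "\<forall>p\<in>S - {z}. overlap p z + k < length z" "reduced (word_prod (z # zs))" "k < length z"
    using Cons.IH[OF yz(4,5)] by blast
  define P where "P = word_prod (z # zs)"
  define c where "c = overlap (word_inv y) z"
  have c: "c + k < length z"
    using kr(3) yz red by (auto simp: c_def)
  have cP: "overlap (word_inv y) P = c"
    unfolding P_def kr(1) c_def using c by (intro overlap_take_append) (auto simp: c_def)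
  have "y \<star> P = word_inv (drop c (word_inv y)) @ drop c P"
    using mult_overlap[of "word_inv y" P] red kr(4) cP P_def by (simp add: reduced_word_inv)
  moreover have "word_inv (drop c (word_inv y)) = take (length y - c) y"
    by (simp add: word_inv_def rev_map drop_rev o_def flip: drop_map take_map)
  moreover have "Suc (length zs) \<le> length (drop c P)"
    unfolding P_def kr(1) using c kr(2) by simp
  moreover have "overlap p y + c < length y" if "p \<in> S - {y}" for p
  proof -
    have "\<forall>p\<in>S - {y}. \<forall>q\<in>S - {word_inv y}. overlap p y + overlap q (word_inv y) < length y"
      using S yz(1) by (simp add: nielsen_reduced_def)
    then have "overlap p y + overlap z (word_inv y) < length y"
      using yz(2,3) that by simp
    then show ?thesis
      by (simp add: c_def overlap_sym)
  qed
  moreover have "reduced (y \<star> P)"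
    using kr(4) by (auto simp: P_def intro: reduced_mult)
  moreover have "c < length y"
  proof -
    have "word_inv y \<in> S - {y}"
      using red nielsen_reduced_inv_neq[OF S yz(1)] by auto
    then have "overlap (word_inv y) y + overlap z (word_inv y) < length y"
      using S yz(1-3) by (simp add: nielsen_reduced_def)
    then show ?thesis
      by (simp add: c_def overlap_sym)
  qed
  ultimately show ?case
    by (intro exI[of _ c] exI[of _ "drop c P"]) (auto simp: P_def)
qed

lemma overlap_ge: "take k u = take k v \<Longrightarrow> k \<le> length u \<Longrightarrow> k \<le> overlap u v"
proof (induction u v arbitrary: k rule: overlap.induct)
  case (1 a u b v)
  then show ?case by (cases k) auto
qed (auto simp: neq_Nil_conv)

lemma nielsen_reduced_length:
  assumes "nielsen_reduced S" "set ys \<subseteq> S" "successively (\<lambda>x y. y \<noteq> word_inv x) ys"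
  shows "length ys \<le> length (word_prod ys)"
proof (cases ys)
  case (Cons y zs)
  obtain k r where "word_prod (y # zs) = take (length y - k) y @ r" "length zs \<le> length r" "k < length y"
    using nielsen_reduced_prod[OF assms(1), of y zs] assms(2,3) Cons by blast
  then show ?thesis
    using Cons by simp
qed simp

lemma generate_word_prod:
  assumes S: "\<And>y. y \<in> S \<Longrightarrow> reduced y \<and> word_inv y \<in> S" and w: "w \<in> generate free_group S"
  shows "\<exists>ys. set ys \<subseteq> S \<and> successively (\<lambda>x y. y \<noteq> word_inv x) ys \<and> w = word_prod ys"
proof -
  have red: "reduced (word_prod ys)" if "set ys \<subseteq> S" for ys
    using that by (induction ys) (auto intro: reduced_mult)
  have "\<exists>ys. set ys \<subseteq> S \<and> w = word_prod ys"
    using w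
  proof induction
    case one
    show ?case by (intro exI[of _ "[]"]) (simp add: free_one)
  next
    case (incl y)
    then show ?case
      using S[of y] by (intro exI[of _ "[y]"]) simp
  next
    case (inv y)
    then show ?case
      using S[of y] inv_eq_word_inv[of y] reduced_word_inv[of y]
      by (intro exI[of _ "[word_inv y]"]) simp
  next
    case (eng v w)
    then obtain xs ys where *: "set xs \<subseteq> S" "v = word_prod xs" "set ys \<subseteq> S" "w = word_prod ys"
      by blast
    have "word_prod (xs @ ys) = word_prod xs \<star> word_prod ys"
      using *(1)
    proof (induction xs)
      case Nil
      then show ?case by (simp add: free_mult)
    next
      case (Cons x xs)
      then show ?case
        using S red[of xs] red[OF *(3)] free.m_assoc[of x "word_prod xs" "word_prod ys"] by simp
    qed
    then show ?case
      using * by (intro exI[of _ "xs @ ys"]) simp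
  qed
  then obtain ys where ys: "set ys \<subseteq> S" "w = word_prod ys"
    by blast
  have "\<exists>zs. set zs \<subseteq> S \<and> successively (\<lambda>x y. y \<noteq> word_inv x) zs \<and> word_prod ys = word_prod zs"
    using ys(1)
  proof (induction ys)
    case Nil
    show ?case by (intro exI[of _ "[]"]) simp
  next
    case (Cons y ys)
    then obtain zs where zs: "set zs \<subseteq> S" "successively (\<lambda>x y. y \<noteq> word_inv x) zs"
        "word_prod ys = word_prod zs"
      by auto
    have y: "y \<in> S" "reduced y"
      using Cons.prems S by auto
    show ?case
    proof (cases "zs \<noteq> [] \<and> hd zs = word_inv y")
      case True
      then obtain zs' where zs': "zs = word_inv y # zs'"
        by (cases zs) auto
      then have "y \<star> word_prod zs = word_prod zs'"
        using free.mult_inv_cancel(1)[of y "word_prod zs'"] red[of zs'] y zs(1)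
        by (simp add: inv_eq_word_inv)
      then show ?thesis
        using zs zs' by (intro exI[of _ zs']) (auto simp: successively_Cons)
    next
      case False
      then show ?thesis
        using zs y by (intro exI[of _ "y # zs"]) (auto simp: successively_Cons)
    qed
  qed
  then show ?thesis
    using ys(2) by simp
qed

text \<open>A letter has length \<open>1\<close>, so its expression as a reduced product of elements of \<open>S\<close> has a single
  factor.\<close>

lemma letter_in_nielsen_reduced:
  assumes S: "nielsen_reduced S" and gen: "generate free_group S = carrier free_group"
  shows "[l] \<in> S"
proof -
  have "[l] \<in> generate free_group S"
    by (simp add: gen)
  then obtain ys where ys: "set ys \<subseteq> S" "successively (\<lambda>x y. y \<noteq> word_inv x) ys" "[l] = word_prod ys"
    using generate_word_prod[of S "[l]"] S by (auto simp: nielsen_reduced_def)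
  have len: "length ys \<le> 1"
    using nielsen_reduced_length[OF S ys(1,2)] ys(3)[symmetric] by simp
  show ?thesis
  proof (cases ys)
    case Nil
    then show ?thesis using ys(3) by simp
  next
    case (Cons y zs)
    then have "y \<in> S" "zs = []"
      using len ys(1) by auto
    moreover have "reduced y"
      using S \<open>y \<in> S\<close> by (simp add: nielsen_reduced_def)
    ultimately show ?thesis
      using ys(3) Cons by simp
  qed
qed

section \<open>Generating pairs of minimal length\<close>

definition minimal_pair :: "('g \<times> bool) list \<Rightarrow> ('g \<times> bool) list \<Rightarrow> bool"
  where "minimal_pair u v \<longleftrightarrow> reduced u \<and> reduced v \<and>
    (\<forall>p q. free.nielsen u v p q \<longrightarrow> length u + length v \<le> length p + length q)"

lemma minimal_pairD: "minimal_pair u v \<Longrightarrow> free.nielsen u v p q \<Longrightarrow> length u + length v \<le> length p + length q"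
  by (simp add: minimal_pair_def)

lemma minimal_pair_swap:
  assumes "minimal_pair u v"
  shows "minimal_pair v u"
proof -
  have "reduced u" "reduced v"
    using assms by (simp_all add: minimal_pair_def)
  then show ?thesis
    unfolding minimal_pair_def
    using minimal_pairD[OF assms free.nielsen_trans[OF _ free.nielsen_swap[OF free.nielsen_refl]]]
    by (simp add: add.commute)
qed

lemma minimal_pair_inv:
  assumes "minimal_pair u v"
  shows "minimal_pair (word_inv u) v"
proof -
  have "reduced u" "reduced v"
    using assms by (simp_all add: minimal_pair_def)
  moreover have "free.nielsen u v (word_inv u) v"
    using free.nielsen_inv[OF free.nielsen_refl, of u v] \<open>reduced u\<close> by (simp add: inv_eq_word_inv)
  ultimately show ?thesis
    unfolding minimal_pair_def
    using minimal_pairD[OF assms free.nielsen_trans] reduced_word_inv[of u] by simp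
qed

text \<open>More than half of one entry in the overlap would make a Nielsen move shorten the other entry.\<close>

lemma minimal_pair_overlap:
  assumes "minimal_pair u v" 
  shows "2 * overlap v u \<le> length u" "2 * overlap v u \<le> length v"
proof -
  have red: "reduced u" "reduced v"
    using assms by (simp_all add: minimal_pair_def)
  have inv: "v\<^sup>- = word_inv v" "u\<^sup>- = word_inv u"
    using red by (simp_all add: inv_eq_word_inv)
  have n: "free.nielsen u v (u\<^sup>- \<star> v) v"
    by (rule free.nielsen_mult[OF free.nielsen_inv[OF free.nielsen_refl]])
  have "free.nielsen u v (v\<^sup>- \<star> u) u"
    by (rule free.nielsen_mult[OF free.nielsen_inv[OF free.nielsen_swap[OF free.nielsen_refl]]])
  then have "length u + length v \<le> length (word_inv v \<star> u) + length u"
    using minimal_pairD[OF assms] inv by metis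
  then show "2 * overlap v u \<le> length u"
    using length_mult_overlap[of v u] red by simp
  have "length u + length v \<le> length (word_inv u \<star> v) + length v"
    using minimal_pairD[OF assms n] inv by metis
  then show "2 * overlap v u \<le> length v"
    using length_mult_overlap[of u v] red by (simp add: overlap_sym)
qed

lemma minimal_pair_inv2: "minimal_pair u v \<Longrightarrow> minimal_pair u (word_inv v)"
  by (intro minimal_pair_swap[of "word_inv v"] minimal_pair_inv minimal_pair_swap[of u])

text \<open>The only obstruction to being Nielsen reduced that survives the moves without conjugation is
  \<open>u = s t\<^sup>-\<close> and \<open>v = s r t\<^sup>-\<close> with \<open>s\<close> and \<open>t\<close> of equal length. Then
  \<open>u\<^sup>-v = t r t\<^sup>-\<close>, and conjugation by \<open>t\<^sup>-\<close> turns \<open>(u, u\<^sup>-v)\<close> into the shorter pair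
  \<open>(t\<^sup>-s, r)\<close>.\<close>

lemma minimal_pair_no_half_overlaps:
  assumes min: "minimal_pair u v" and u: "u \<noteq> []"
    and o1: "2 * overlap v u = length u" and o2: "2 * overlap (word_inv v) (word_inv u) = length u"
  shows False
proof -
  define m where "m = overlap v u"
  define s where "s = take m u"
  define t where "t = take m (word_inv u)"
  have red: "reduced u" "reduced v"
    using min by (simp_all add: minimal_pair_def)
  have m: "length u = 2 * m" "overlap (word_inv v) (word_inv u) = m" "m > 0"
    using o1 o2 length_greater_0_conv[of u] u unfolding m_def by linarith+
  have lv: "2 * m \<le> length v"
    using minimal_pair_overlap[OF min] by (simp add: m_def)
  have drop_t: "word_inv t = drop m u"
    using m by (simp add: t_def word_inv_def take_rev rev_map o_def flip: drop_map take_map)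
  have us: "u = s @ word_inv t"
    by (simp add: s_def drop_t)
  define r where "r = drop m (take (length v - m) v)"
  have v1: "take m v = s"
    using take_overlap[of m v u] by (simp add: m_def s_def)
  have "take m (word_inv v) = t"
    using take_overlap[of m "word_inv v" "word_inv u"] m by (simp add: t_def)
  then have v2: "drop (length v - m) v = word_inv t"
    by (auto simp: word_inv_def rev_map take_map take_rev o_def)
  have "take (length v - m) v = take m (take (length v - m) v) @ r"
    by (simp only: r_def append_take_drop_id)
  also have "take m (take (length v - m) v) = s"
    using lv v1 by (simp add: min_absorb1)
  finally have vs: "v = s @ r @ word_inv t"
    using append_take_drop_id[of "length v - m" v] v2 by simp
  have red': "reduced s" "reduced (word_inv t)" "reduced t" "reduced r" "reduced (r @ word_inv t)"
    using red us vs by (auto simp: reduced_append_iff dest: reduced_word_inv)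
  have us': "u = s \<star> t\<^sup>-"
    using us red(1) mult_append[of s "word_inv t"] red' inv_eq_word_inv[of t] by simp
  have vs': "v = s \<star> (r \<star> t\<^sup>-)"
    using vs red(2) mult_append[of s "r @ word_inv t"] mult_append[of r "word_inv t"] red' 
      inv_eq_word_inv[of t] by simp
  have "free.nielsen u v u ((v\<^sup>- \<star> u)\<^sup>-)"
    by (rule free.nielsen_swap[OF free.nielsen_inv[OF free.nielsen_mult[OF free.nielsen_inv[OF
      free.nielsen_swap[OF free.nielsen_refl]]]]])
  also have "(v\<^sup>- \<star> u)\<^sup>- = u\<^sup>- \<star> v"
    using red by (simp add: free.inv_mult_group)
  finally have "free.nielsen u v u (u\<^sup>- \<star> v)" .
  then have "free.nielsen u v (t\<^sup>- \<star> u \<star> t\<^sup>-\<^sup>-) (t\<^sup>- \<star> (u\<^sup>- \<star> v) \<star> t\<^sup>-\<^sup>-)"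
    by (rule free.nielsen_conj) (use red' in simp)
  also have "t\<^sup>- \<star> u \<star> t\<^sup>-\<^sup>- = t\<^sup>- \<star> s"
    unfolding us' using red' by (simp add: free.group_word_simps)
  also have "t\<^sup>- \<star> (u\<^sup>- \<star> v) \<star> t\<^sup>-\<^sup>- = r"
    unfolding us' vs' using red' by (simp add: free.group_word_simps)
  finally have "length u + length v \<le> length (t\<^sup>- \<star> s) + length r"
    using minimal_pairD[OF min] by blast
  moreover have "length (t\<^sup>- \<star> s) \<le> length u"
    using mult_length[of "word_inv t" s] red' m by (simp add: inv_eq_word_inv s_def t_def)
  moreover have "length r < length v"
    using m lv by (simp add: r_def)
  ultimately show False by simp
qed

text \<open>Each overlap takes up at most half of \<open>u\<close>, and less than half if the other word is \<open>u\<^sup>-\<close> or \<open>u\<close>.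
  So the inequality fails only if both neighbours of \<open>u\<close> are \<open>v\<close> or its inverse and cancel exactly one half
  of it.\<close>

lemma minimal_pair_overlaps_left:
  assumes min: "minimal_pair u v" and u: "u \<noteq> []"
    and p: "p \<in> {word_inv u, v, word_inv v}" and q: "q \<in> {u, v, word_inv v}"
  shows "overlap p u + overlap q (word_inv u) < length u"
proof (rule ccontr)
  assume *: "\<not> ?thesis"
  have red: "reduced u" "reduced v"
    using min by (simp_all add: minimal_pair_def)
  have uu: "2 * overlap (word_inv u) u < length u" "2 * overlap u (word_inv u) < length u"
    using overlap_inverse[OF red(1) u] by (simp_all add: overlap_sym)
  have vu: "2 * overlap v u \<le> length u" "2 * overlap (word_inv v) u \<le> length u"
      "2 * overlap v (word_inv u) \<le> length u" "2 * overlap (word_inv v) (word_inv u) \<le> length u"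
    using minimal_pair_overlap(1)[OF min] minimal_pair_overlap(1)[OF minimal_pair_inv2[OF min]]
      minimal_pair_overlap(1)[OF minimal_pair_inv[OF min]]
      minimal_pair_overlap(1)[OF minimal_pair_inv[OF minimal_pair_inv2[OF min]]] by simp_all
  have eq: "2 * overlap p u = length u" "2 * overlap q (word_inv u) = length u" "p \<noteq> word_inv u" "q \<noteq> u"
    using * p q uu vu by auto
  have pq: "minimal_pair u p" "q = p \<or> q = word_inv p"
    using p q eq min minimal_pair_inv2[OF min] by auto
  show False
  proof (cases "q = p")
    case True
    \<comment> \<open>Then both halves of \<open>u\<close> cancel against the same prefix of \<open>p\<close>, so \<open>u\<close> would be trivial.\<close>
    define m where "m = overlap p u"
    have "take m u = take m p"
      using take_overlap[of m p u] by (simp add: m_def)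
    moreover have "take m (word_inv u) = take m p"
      using take_overlap[of m p "word_inv u"] eq True by (simp add: m_def)
    moreover have "m \<le> length u" "m > 0"
      using eq(1) length_greater_0_conv[of u] u unfolding m_def by linarith+
    ultimately have "m \<le> overlap (word_inv u) u"
      by (intro overlap_ge) (auto simp: min_def split: if_splits)
    then show False
      using uu eq(1) by (simp add: m_def)
  next
    case False
    then show False
      using minimal_pair_no_half_overlaps[OF pq(1) u] eq pq by auto
  qed
qed

text \<open>The trivial word has to be left out of \<open>S\<close>: it is never part of a Nielsen reduced set, and that the
  entries of a minimal generating pair are nontrivial is only a consequence of this lemma.\<close>

lemma minimal_pair_letter:
  assumes min: "minimal_pair u v" and gen: "generate free_group {u, v} = carrier free_group"
  shows "[l] \<in> {u, word_inv u, v, word_inv v}"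
proof -
  define S where "S = {u, word_inv u, v, word_inv v} - {[]}"
  have red: "reduced u" "reduced v"
    using min by (simp_all add: minimal_pair_def)
  have carr: "S \<subseteq> carrier free_group"
    using red by (auto simp: S_def reduced_word_inv)
  have over: "overlap p y + overlap q (word_inv y) < length y"
    if yS: "y \<in> S" and pq: "p \<in> S - {y}" "q \<in> S - {word_inv y}" for y p q
  proof -
    have y: "y \<noteq> []"
      using yS by (simp add: S_def)
    obtain z where z: "minimal_pair y z" "{u, word_inv u, v, word_inv v} = {y, word_inv y, z, word_inv z}"
    proof -
      consider "y = u" | "y = word_inv u" | "y = v" | "y = word_inv v"
        using yS by (auto simp: S_def)
      then show ?thesis
      proof cases
        case 1
        then show ?thesis using that[of v] min by auto
      next
        case 2
        then show ?thesis using that[of v] minimal_pair_inv[OF min] by auto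
      next
        case 3
        then show ?thesis using that[of u] minimal_pair_swap[OF min] by auto
      next
        case 4
        then show ?thesis using that[of u] minimal_pair_inv[OF minimal_pair_swap[OF min]] by auto
      qed
    qed
    then have "p \<in> {word_inv y, z, word_inv z}" "q \<in> {y, z, word_inv z}"
      using pq unfolding S_def z(2) by auto
    then show ?thesis
      by (rule minimal_pair_overlaps_left[OF z(1) y])
  qed
  have "nielsen_reduced S"
    unfolding nielsen_reduced_def using over red by (auto simp: S_def reduced_word_inv)
  moreover have "generate free_group S = carrier free_group"
  proof -
    have sub: "subgroup (generate free_group S) free_group"
      by (rule free.generate_is_subgroup[OF carr])
    have "{u, v} \<subseteq> generate free_group S"
      using subgroup.one_closed[OF sub] by (auto simp: S_def intro: generate.incl)
    then show ?thesis
      using free.generate_subgroup_incl[OF _ sub, of "{u, v}"] gen subgroup.subset[OF sub] by blast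
  qed
  ultimately show ?thesis
    using letter_in_nielsen_reduced[of S l] by (auto simp: S_def)
qed

abbreviation F2_nielsen :: "(2 \<times> bool) list \<Rightarrow> (2 \<times> bool) list \<Rightarrow> bool"
  where "F2_nielsen \<equiv> free.nielsen (gen 1) (gen 2)"

text \<open>A pair of least total length among those reachable from \<open>(u, v)\<close> has every letter among its entries
  and their inverses, so it consists of the standard generators up to order and inversion; and Nielsen
  moves can be reversed.\<close>

theorem generating_pair_nielsen:
  assumes red: "reduced u" "reduced v" and gen: "generate F2 {u, v} = carrier F2"
  shows "F2_nielsen u v"
proof -
  have carr: "u \<in> carrier F2" "v \<in> carrier F2"
    using red by simp_all
  obtain p q where pq: "free.nielsen u v p q"
    and least: "\<And>p' q'. free.nielsen u v p' q' \<Longrightarrow> length p + length q \<le> length p' + length q'"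
    using ex_has_least_nat[of "\<lambda>(p, q). free.nielsen u v p q" "(u, v)" "\<lambda>(p, q). length p + length q"]
      free.nielsen_refl[of u v] by auto
  have pqc: "p \<in> carrier F2" "q \<in> carrier F2"
    using free.nielsen_closed[OF pq carr] .
  have "minimal_pair p q"
    unfolding minimal_pair_def using pqc least free.nielsen_trans[OF _ pq] by simp
  moreover have "generate F2 {p, q} = carrier F2"
    by (rule free.nielsen_generate[OF pq carr gen])
  ultimately have letter: "[l] \<in> {p, word_inv p, q, word_inv q}" for l
    using minimal_pair_letter by blast
  have split: "x = w \<or> x = word_inv w" if "w = x \<or> w = word_inv x" for w x :: "(2 \<times> bool) list"
    using that by auto
  have letters: "([(1, True)] = p \<or> [(1, True)] = word_inv p) \<and> ([(2, True)] = q \<or> [(2, True)] = word_inv q)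
    \<or> ([(1, True)] = q \<or> [(1, True)] = word_inv q) \<and> ([(2, True)] = p \<or> [(2, True)] = word_inv p)"
  proof -
    have "\<not> (([(1, True)] = w \<or> [(1, True)] = word_inv w) \<and> ([(2, True)] = w \<or> [(2, True)] = word_inv w))"
      for w :: "(2 \<times> bool) list"
      using split by (auto simp: word_inv_def letter_inv_def dest: arg_cong[of _ _ word_inv])
    then show ?thesis
      using letter[of "(1, True)"] letter[of "(2, True)"] by auto
  qed
  have invs: "word_inv (gen x) = inv\<^bsub>F2\<^esub> (gen x)" for x
    by (simp add: inv_eq_word_inv)
  have "F2_nielsen p q"
  proof -
    have *: "F2_nielsen p' q'" if "p' = gen 1 \<or> p' = word_inv (gen 1)" "q' = gen 2 \<or> q' = word_inv (gen 2)" for p' q'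
      using that free.nielsen_refl[of "gen 1" "gen 2"] unfolding invs
      by (auto intro: free.nielsen_inv free.nielsen_inv2)
    show ?thesis
      using letters *[of p q] *[of q p] free.nielsen_swap split by blast
  qed
  then show ?thesis
    using free.nielsen_trans free.nielsen_sym[OF pq carr] by blast
qed

section \<open>Pairs of positive words and automorphisms acting trivially on the abelianisation\<close>

text \<open>This is applied to letters \<open>x\<close> and \<open>y\<close> of different generators, which may be inverses of generators.
  Words in them are reduced as they stand, and lengths can be read off from exponent sums.\<close>

inductive positive_pair for x y :: "'g \<times> bool"
  where
    positive_letters: "positive_pair x y [x] [y]"
  | positive_left: "positive_pair x y u v \<Longrightarrow> positive_pair x y (u @ v) v"
  | positive_right: "positive_pair x y u v \<Longrightarrow> positive_pair x y u (u @ v)"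

lemma positive_pair_set:
  assumes "positive_pair x y u v"
  shows "set u \<subseteq> {x, y}" "set v \<subseteq> {x, y}" "u \<noteq> []" "v \<noteq> []"
  using assms by induction auto

lemma reduced_two_letters:
  assumes "fst x \<noteq> fst y" "set w \<subseteq> {x, y}"
  shows "reduced w"
  using assms(2)
proof (induction w)
  case (Cons a w)
  then show ?case
    using assms(1) by (cases w) (auto simp: letter_inv_def prod_eq_iff)
qed simp

text \<open>Pairs that are positive up to exchange, inversion of entries and simultaneous conjugation. They are
  closed under Nielsen moves (\<open>coherent_mult_all\<close>), so every generating pair of \<open>F2\<close> is one of them.\<close>

inductive coherent_pair :: "('g \<times> bool) list \<Rightarrow> ('g \<times> bool) list \<Rightarrow> bool"
  where
    coherent_positive: "fst x \<noteq> fst y \<Longrightarrow> positive_pair x y p q \<Longrightarrow> coherent_pair p q"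
  | coherent_swap: "coherent_pair u v \<Longrightarrow> coherent_pair v u"
  | coherent_inv: "coherent_pair u v \<Longrightarrow> coherent_pair (u\<^sup>-) v"
  | coherent_conj: "coherent_pair u v \<Longrightarrow> reduced g \<Longrightarrow> coherent_pair (g \<star> u \<star> g\<^sup>-) (g \<star> v \<star> g\<^sup>-)"

lemma coherent_inv2: "coherent_pair u v \<Longrightarrow> coherent_pair u (v\<^sup>-)"
  using coherent_swap coherent_inv by metis

lemma coherent_conj':
  assumes "coherent_pair u v" "reduced g" "u' = g \<star> u \<star> g\<^sup>-" "v' = g \<star> v \<star> g\<^sup>-"
  shows "coherent_pair u' v'"
  using coherent_conj[OF assms(1,2)] assms(3,4) by simp

lemma coherent_reduced:
  assumes "coherent_pair u v"
  shows "reduced u" "reduced v"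
proof -
  have "reduced u \<and> reduced v"
    using assms
  proof induction
    case (coherent_positive x y p q)
    then show ?case
      using reduced_two_letters positive_pair_set by metis
  qed (auto intro: free_mult_closed free_inv_closed)
  then show "reduced u" "reduced v" by auto
qed

text \<open>A quotient undoes the last concatenation when it can. Otherwise it produces, up to
  conjugation, inversion and exchange, the pair with the other concatenation in the last place, or, if no
  concatenation has been made, a positive pair in one of the letters and the inverse of the other.\<close>

lemma coherent_positive_div:
  assumes xy: "fst x \<noteq> fst y" and pos: "positive_pair x y p q"
  shows "coherent_pair (p \<star> q\<^sup>-) q \<and> coherent_pair (q \<star> p\<^sup>-) p"
  using pos
proof cases
  case positive_letters
  have inv: "[a]\<^sup>- = [letter_inv a]" for a :: "'a \<times> bool"
    by (simp add: inv_eq_word_inv word_inv_def)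
  have *: "coherent_pair ([a] \<star> [b]\<^sup>-) [b]" if ab: "fst a \<noteq> fst b" for a b :: "'a \<times> bool"
  proof -
    have ab': "fst a \<noteq> fst (letter_inv b)"
      using ab by (simp add: letter_inv_def)
    then have "coherent_pair ([a] @ [letter_inv b]) [letter_inv b]"
      using coherent_positive positive_pair.intros by metis
    moreover have "[a] @ [letter_inv b] = [a] \<star> [b]\<^sup>-"
      unfolding inv using ab by (intro mult_append[symmetric]) (auto simp: letter_inv_def prod_eq_iff)
    moreover have "[letter_inv b]\<^sup>- = [b]"
      unfolding inv by simp
    ultimately show ?thesis
      using coherent_inv2 by metis
  qed
  then show ?thesis
    unfolding positive_letters using xy by simp
next
  case (positive_left u)
  have red: "reduced u" "reduced q" "reduced p" "reduced (u @ q)"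
    using reduced_two_letters[OF xy] positive_pair_set[OF positive_left(2)] positive_left(1) by auto
  have p: "p = u \<star> q"
    using positive_left red mult_append by metis
  have "coherent_pair u q"
    by (rule coherent_positive[OF xy positive_left(2)])
  moreover have "coherent_pair (u\<^sup>-) p"
    unfolding positive_left(1)
    by (rule coherent_inv[OF coherent_positive[OF xy positive_pair.positive_right[OF positive_left(2)]]])
  moreover have "p \<star> q\<^sup>- = u" "q \<star> p\<^sup>- = u\<^sup>-"
    unfolding p using red by (simp_all add: free_word_simps)
  ultimately show ?thesis
    by simp
next
  case (positive_right v)
  have red: "reduced v" "reduced q" "reduced p" "reduced (p @ v)"
    using reduced_two_letters[OF xy] positive_pair_set[OF positive_right(2)] positive_right(1) by auto
  have q: "q = p \<star> v"
    using positive_right red mult_append by metis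
  have "coherent_pair (p \<star> v) v"
    using coherent_positive[OF xy positive_pair.positive_left[OF positive_right(2)]] red mult_append by metis
  then have "coherent_pair (v \<star> p) v"
    by (rule coherent_conj'[of _ _ v]) (use red in \<open>simp_all add: free_word_simps\<close>)
  then have "coherent_pair (v\<^sup>-) (v \<star> p)"
    by (intro coherent_inv coherent_swap[of "v \<star> p"])
  then have "coherent_pair (p \<star> q\<^sup>-) q"
    by (rule coherent_conj'[of _ _ p]) (use red in \<open>simp_all add: q free_word_simps\<close>)
  moreover have "coherent_pair (q \<star> p\<^sup>-) p"
    by (rule coherent_conj'[OF coherent_swap[OF coherent_positive[OF xy positive_right(2)]], of p])
      (use red in \<open>simp_all add: q free_word_simps\<close>)
  ultimately show ?thesis by simp
qed

text \<open>The four products are treated together, since exchanging or inverting the entries permutes them up to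
  conjugation and inversion.\<close>

lemma coherent_mult_all:
  assumes "coherent_pair u v"
  shows "coherent_pair (u \<star> v) v \<and> coherent_pair (u \<star> v\<^sup>-) v \<and>
    coherent_pair (v \<star> u) u \<and> coherent_pair (v \<star> u\<^sup>-) u"
  using assms
proof induction
  case (coherent_positive x y p q)
  have red: "reduced p" "reduced q" "reduced (p @ q)"
    using reduced_two_letters[OF coherent_positive(1)] positive_pair_set[OF coherent_positive(2)] by auto
  have pq: "p @ q = p \<star> q"
    using mult_append red by metis
  have "coherent_pair (p \<star> q) q"
    using coherent_pair.coherent_positive[OF coherent_positive(1) positive_left[OF coherent_positive(2)]] pq
    by simp
  moreover have "coherent_pair (p \<star> q) p"
    using coherent_swap[OF coherent_pair.coherent_positive[OF coherent_positive(1)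
          positive_right[OF coherent_positive(2)]]] pq by simp
  then have "coherent_pair (q \<star> p) p"
    by (rule coherent_conj'[of _ _ "p\<^sup>-"]) (use red in \<open>simp_all add: free_word_simps free_inv_closed\<close>)
  ultimately show ?case
    using coherent_positive_div[OF coherent_positive] by simp
next
  case (coherent_swap u v)
  then show ?case by simp
next
  case (coherent_inv u v)
  have red: "reduced u" "reduced v"
    using coherent_reduced[OF coherent_inv(1)] by auto
  have "coherent_pair (v\<^sup>- \<star> u) v"
    by (rule coherent_conj'[of "u \<star> v\<^sup>-" v "v\<^sup>-"])
      (use coherent_inv red in \<open>simp_all add: free_word_simps free_inv_closed\<close>)
  then have "coherent_pair ((v\<^sup>- \<star> u)\<^sup>-) v"
    by (rule coherent_pair.coherent_inv)
  moreover have "coherent_pair (v \<star> u) v"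
    by (rule coherent_conj'[of "u \<star> v" v "v"])
      (use coherent_inv red in \<open>simp_all add: free_word_simps free_inv_closed\<close>)
  then have "coherent_pair ((v \<star> u)\<^sup>-) v"
    by (rule coherent_pair.coherent_inv)
  moreover have "coherent_pair (v \<star> u\<^sup>-) (u\<^sup>-)" "coherent_pair (v \<star> u) (u\<^sup>-)"
    using coherent_inv coherent_inv2 by auto
  ultimately show ?case
    using red by (simp add: free_word_simps free_inv_closed)
next
  case (coherent_conj u v g)
  have red: "reduced u" "reduced v"
    using coherent_reduced[OF coherent_conj(1)] by auto
  have eq: "(g \<star> w \<star> g\<^sup>-) \<star> (g \<star> w' \<star> g\<^sup>-) = g \<star> (w \<star> w') \<star> g\<^sup>-"
      "(g \<star> w \<star> g\<^sup>-) \<star> (g \<star> w' \<star> g\<^sup>-)\<^sup>- = g \<star> (w \<star> w'\<^sup>-) \<star> g\<^sup>-"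
    if "reduced w" "reduced w'" for w w'
    using that coherent_conj(2) by (simp_all add: free_word_simps free_inv_closed free_mult_closed)
  show ?case
    unfolding eq[OF red] eq[OF red(2,1)]
    using coherent_conj by (auto intro: coherent_pair.coherent_conj)
qed

lemma nielsen_coherent:
  assumes "F2_nielsen u v"
  shows "coherent_pair u v"
  using assms
proof induction
  case nielsen_refl
  have "positive_pair (1 :: 2, True) (2, True) (gen 1) (gen 2)"
    by (rule positive_letters)
  then show ?case
    by (rule coherent_positive[rotated]) simp
next
  case (nielsen_swap u v)
  then show ?case using coherent_swap by blast
next
  case (nielsen_inv u v)
  then show ?case by (intro coherent_inv)
next
  case (nielsen_mult u v)
  then show ?case using coherent_mult_all by blast
next
  case (nielsen_conj u v g)
  then show ?case by (intro coherent_conj) auto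
qed

definition letter_sign :: "'g \<times> bool \<Rightarrow> int"
  where "letter_sign a = (if snd a then 1 else - 1)"

lemma abelianise_Cons: "abelianise (a # w) = axis (fst a) (letter_sign a) + abelianise w"
  by (cases a) (simp add: letter_sign_def)

text \<open>In a word in two letters of different generators the exponent sums involve no cancellation.\<close>

lemma positive_length:
  assumes xy: "fst x \<noteq> fst y" and "set w \<subseteq> {x, y}"
  shows "letter_sign x * abelianise w $ fst x + letter_sign y * abelianise w $ fst y = int (length w)"
  using assms(2)
proof (induction w)
  case (Cons a w)
  then show ?case
    using xy by (auto simp: abelianise_Cons axis_def algebra_simps letter_sign_def)
qed simp

lemma positive_axis:
  assumes xy: "fst x \<noteq> fst y" and w: "set w \<subseteq> {x, y}" "w \<noteq> []" and l: "abelianise w = abelianise [l]"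
  shows "\<exists>m. w = [m]"
proof -
  have "letter_sign x * abelianise [l] $ fst x + letter_sign y * abelianise [l] $ fst y \<le> 1"
    using xy by (auto simp: abelianise_Cons axis_def letter_sign_def)
  then have "length w \<le> 1"
    using positive_length[OF xy w(1)] l by simp
  then show ?thesis
    using w(2) by (cases w) auto
qed

lemma abelianise_conj:
  assumes "reduced g"
  shows "abelianise (g \<star> w \<star> g\<^sup>-) = abelianise w"
  using assms by (simp add: abelianise_mult abelianise_inv)

text \<open>All rules of \<open>coherent_pair\<close> preserve the hypothesis that both exponent vectors are those of letters,
  and the conclusion, so the claim reduces to \<open>positive_axis\<close>.\<close>

lemma coherent_axis:
  assumes "coherent_pair u v" "abelianise u = abelianise [l]" "abelianise v = abelianise [m]"
  shows "\<exists>g l' m'. reduced g \<and> u = g \<star> [l'] \<star> g\<^sup>- \<and> v = g \<star> [m'] \<star> g\<^sup>-"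
  using assms
proof (induction arbitrary: l m)
  case (coherent_positive x y p q)
  then obtain l' m' where "p = [l']" "q = [m']"
    using positive_axis positive_pair_set by metis
  moreover have "[a] = [] \<star> [a] \<star> []\<^sup>-" for a :: "'a \<times> bool"
    by (simp add: inv_eq_word_inv)
  moreover have "reduced ([] :: ('a \<times> bool) list)"
    by simp
  ultimately show ?case
    by blast
next
  case (coherent_swap u v)
  then show ?case by metis
next
  case (coherent_inv u v)
  have red: "reduced u" "reduced v"
    using coherent_reduced[OF coherent_inv(1)] by auto
  have inv: "[a]\<^sup>- = [letter_inv a]" for a :: "'a \<times> bool"
    by (simp add: inv_eq_word_inv word_inv_def)
  have "- abelianise u = abelianise [l]"
    using coherent_inv.prems(1) abelianise_inv[of u] red by simp
  then have "abelianise u = - abelianise [l]"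
    by (metis minus_minus)
  also have "\<dots> = abelianise [letter_inv l]"
    by (simp add: abelianise_Cons letter_sign_def letter_inv_def axis_minus)
  finally obtain g l' m' where *: "reduced g" "u = g \<star> [l'] \<star> g\<^sup>-" "v = g \<star> [m'] \<star> g\<^sup>-"
    using coherent_inv.IH coherent_inv.prems(2) by blast
  have "u\<^sup>- = g \<star> [letter_inv l'] \<star> g\<^sup>-"
    unfolding *(2) inv[symmetric] using *(1) by (simp add: free_word_simps free_inv_closed)
  then show ?case
    using * by blast
next
  case (coherent_conj u v h)
  have "reduced u" "reduced v"
    using coherent_reduced[OF coherent_conj(1)] by auto
  then obtain g l' m' where *: "reduced g" "u = g \<star> [l'] \<star> g\<^sup>-" "v = g \<star> [m'] \<star> g\<^sup>-"
    using coherent_conj.IH coherent_conj.prems abelianise_conj[OF coherent_conj.hyps(2)] by metis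
  have "h \<star> (g \<star> [a] \<star> g\<^sup>-) \<star> h\<^sup>- = (h \<star> g) \<star> [a] \<star> (h \<star> g)\<^sup>-" for a
    using *(1) coherent_conj.hyps(2) by (simp add: free_word_simps free_inv_closed free_mult_closed)
  then show ?case
    using *(1) coherent_conj.hyps(2) unfolding *(2,3) by (metis free_mult_closed)
qed

lemma generate_gens: "generate F2 {gen 1, gen 2} = carrier F2"
proof -
  have S: "subgroup (generate F2 {gen 1, gen 2}) F2"
    by (rule free.generate_is_subgroup) simp
  have letter: "[a] \<in> generate F2 {gen 1, gen 2}" for a :: "2 \<times> bool"
  proof -
    have g: "gen x \<in> generate F2 {gen 1, gen 2}" for x :: 2
      using exhaust_2[of x] by (auto intro: generate.incl)
    show ?thesis
      using g subgroup.m_inv_closed[OF S g[of "fst a"]] by (cases a; cases "snd a") (auto simp: inv_gen)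
  qed
  have "w \<in> generate F2 {gen 1, gen 2}" if "reduced w" for w :: "(2 \<times> bool) list"
    using that
  proof (induction w)
    case Nil
    show ?case using subgroup.one_closed[OF S] by simp
  next
    case (Cons a w)
    then have "a # w = [a] \<star> w"
      using mult_append[of "[a]" w] by simp
    then show ?case
      using Cons subgroup.m_closed[OF S letter[of a]] reduced_tl[of a w] by simp
  qed
  then show ?thesis
    using subgroup.subset[OF S] by auto
qed

lemma auto_nielsen:
  assumes \<phi>: "\<phi> \<in> auto F2"
  shows "F2_nielsen (\<phi> (gen 1)) (\<phi> (gen 2))"
proof (rule generating_pair_nielsen)
  show "reduced (\<phi> (gen 1))" "reduced (\<phi> (gen 2))"
    using free.auto_closed[OF \<phi>, of "gen _"] by simp_all
  have "generate F2 (\<phi> ` {gen 1, gen 2}) = \<phi> ` generate F2 {gen 1, gen 2}"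
    by (rule group_hom.generate_img[OF free.auto_group_hom[OF \<phi>]]) simp
  also have "\<dots> = carrier F2"
    unfolding generate_gens using \<phi> by (simp add: auto_def Bij_def bij_betw_def)
  finally show "generate F2 {\<phi> (gen 1), \<phi> (gen 2)} = carrier F2"
    by simp
qed

text \<open>The images of the generators are simultaneously conjugate to two letters, and the matrix shows which
  letters these are.\<close>

theorem auto_inner_if_abel_matrix_trivial:
  assumes \<phi>: "\<phi> \<in> auto F2" and A: "abel_matrix \<phi> = mat 1"
  shows "\<phi> \<in> Inn F2"
proof -
  have ab: "abelianise (\<phi> (gen j)) = abelianise (gen j)" for j
  proof -
    have "abel_matrix \<phi> $ i $ j = (mat 1 :: int ^ 2 ^ 2) $ i $ j" for i
      by (simp add: A)
    then show ?thesis
      by (simp add: vec_eq_iff abel_matrix_def mat_def axis_def)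
  qed
  obtain g l m where g: "reduced g" "\<phi> (gen 1) = g \<star> [l] \<star> g\<^sup>-" "\<phi> (gen 2) = g \<star> [m] \<star> g\<^sup>-"
    using coherent_axis[OF nielsen_coherent[OF auto_nielsen[OF \<phi>]] ab ab] by blast
  have letter: "k = (j, True)" if "abelianise [k] = abelianise (gen j)" for k :: "2 \<times> bool" and j
  proof -
    have "axis (fst k) (letter_sign k) $ fst k = (axis j 1 :: int ^ 2) $ fst k"
      using that by (simp add: abelianise_Cons letter_sign_def)
    then show ?thesis
      by (cases k) (auto simp: axis_def letter_sign_def split: if_splits)
  qed
  have "\<phi> (gen j) = conj_by F2 g (gen j)" for j
  proof -
    have "l = (1, True)" "m = (2, True)"
      using letter[of l 1] letter[of m 2] ab g abelianise_conj[OF g(1)] by metis+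
    then show ?thesis
      using exhaust_2[of j] g by (auto simp: conj_by_def)
  qed
  then have "\<phi> w = conj_by F2 g w" if "reduced w" for w
    using free_group_hom_eq[OF group_free_group auto_hom[OF \<phi>] auto_hom[OF free.conj_by_auto[of g]]]
      g(1) that by simp
  then have "\<phi> = conj_by F2 g"
    using free.auto_ext[OF \<phi>] free.auto_ext[OF free.conj_by_auto[of g]] g(1)
    by (intro extensionalityI[of _ "carrier F2"]) simp_all
  then show ?thesis
    using g(1) by (simp add: Inn_def)
qed

section \<open>Winding numbers of words around lattice points\<close>

lemma abelianise_append: "abelianise (u @ v) = abelianise u + abelianise v"
  by (simp add: abelianise_def)

lemma abelianise_letter_inv: "abelianise [letter_inv a] = - abelianise [a]"
  by (simp add: abelianise_Cons letter_sign_def letter_inv_def axis_minus)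

text \<open>A word is read as a path in the lattice that starts at the origin, and \<open>crossed_hom e\<close> sums the
  contributions \<open>e\<close> of its edges, each translated to the place where the edge is passed. If \<open>e\<close> is
  cancelling, this is the crossed homomorphism on the free group (a derivation, with the group acting on
  functions by translation) that extends the values of \<open>e\<close> on letters.\<close>

fun crossed_hom :: "('g::finite \<times> bool \<Rightarrow> int ^ 'g \<Rightarrow> int) \<Rightarrow> ('g \<times> bool) list \<Rightarrow> int ^ 'g \<Rightarrow> int"
  where
    "crossed_hom e [] x = 0"
  | "crossed_hom e (a # w) x = e a x + crossed_hom e w (x - abelianise [a])"

definition cancelling :: "('g::finite \<times> bool \<Rightarrow> int ^ 'g \<Rightarrow> int) \<Rightarrow> bool"
  where "cancelling e \<longleftrightarrow> (\<forall>a x. e a x + e (letter_inv a) (x - abelianise [a]) = 0)"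

text \<open>Exchanging adjacent letters \<open>a\<close> and \<open>b\<close> in a word does not change its sum.\<close>

definition commuting :: "('g::finite \<times> bool \<Rightarrow> int ^ 'g \<Rightarrow> int) \<Rightarrow> 'g \<times> bool \<Rightarrow> 'g \<times> bool \<Rightarrow> bool"
  where "commuting e a b \<longleftrightarrow> (\<forall>x. e a x + e b (x - abelianise [a]) = e b x + e a (x - abelianise [b]))"

lemma cancellingD: "cancelling e \<Longrightarrow> e a x + e (letter_inv a) (x - abelianise [a]) = 0"
  unfolding cancelling_def by blast

lemma commutingD:
  "commuting e a b \<Longrightarrow> e a x + e b (x - abelianise [a]) = e b x + e a (x - abelianise [b])"
  unfolding commuting_def by blast

lemma crossed_hom_push:
  assumes "cancelling e"
  shows "crossed_hom e (push a w) x = crossed_hom e (a # w) x"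
proof (cases w)
  case (Cons b v)
  have "x - abelianise [a] - abelianise [letter_inv a] = x"
    by (simp only: abelianise_letter_inv) simp
  then have "crossed_hom e (a # letter_inv a # v) x = e a x + e (letter_inv a) (x - abelianise [a]) + crossed_hom e v x"
    by (simp only: crossed_hom.simps add.assoc)
  then show ?thesis
    using Cons cancellingD[OF assms, of a x] by (simp del: crossed_hom.simps)
qed simp

lemma crossed_hom_mult:
  assumes "cancelling e"
  shows "crossed_hom e (u \<star> v) x = crossed_hom e u x + crossed_hom e v (x - abelianise u)"
proof -
  have "crossed_hom e (foldr push u v) x = crossed_hom e u x + crossed_hom e v (x - abelianise u)"
  proof (induction u arbitrary: x)
    case (Cons a u)
    have "abelianise (a # u) = abelianise [a] + abelianise u"
      using abelianise_append[of "[a]" u] by simp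
    then show ?case
      using Cons by (simp add: crossed_hom_push[OF assms] algebra_simps del: abelianise_simps)
  qed simp
  then show ?thesis by (simp add: free_mult)
qed

lemma crossed_hom_move:
  assumes "\<And>b. commuting e a b"
  shows "crossed_hom e (a # u @ v) x = crossed_hom e (u @ a # v) x"
proof (induction u arbitrary: x)
  case (Cons b u)
  show ?case
    using commutingD[OF assms, of x b] Cons[of "x - abelianise [b]"] by (simp add: algebra_simps del: abelianise_simps)
qed simp

lemma letter_inv_mem_if_closed:
  assumes "abelianise (a # w) = 0"
  shows "letter_inv a \<in> set w"
proof (rule ccontr)
  assume *: "\<not> ?thesis"
  have "letter_sign a * abelianise w $ fst a \<ge> 0"
    using *
  proof (induction w)
    case (Cons b w)
    have "letter_sign a * axis (fst b) (letter_sign b) $ fst a \<ge> 0"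
      using Cons.prems by (auto simp: axis_def letter_sign_def letter_inv_def prod_eq_iff)
    then show ?case
      using Cons by (simp add: abelianise_Cons algebra_simps)
  qed simp
  moreover have "letter_sign a * abelianise (a # w) $ fst a = 1 + letter_sign a * abelianise w $ fst a"
    by (simp add: abelianise_Cons axis_def letter_sign_def)
  ultimately show False
    using assms by simp
qed

text \<open>A closed word contains the inverse of its first letter; moving that inverse to the front and cancelling
  shortens the word.\<close>

lemma crossed_hom_closed_eq_0:
  assumes canc: "cancelling e" and comm: "\<And>a b. commuting e a b"
  shows "abelianise w = 0 \<Longrightarrow> crossed_hom e w x = 0"
proof (induction w arbitrary: x rule: length_induct)
  case (1 w)
  show ?case
  proof (cases w)
    case (Cons a w')
    then obtain u v where w': "w' = u @ letter_inv a # v"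
      using letter_inv_mem_if_closed[of a w'] "1.prems" by (metis split_list)
    have "crossed_hom e (u @ letter_inv a # v) y = crossed_hom e (letter_inv a # u @ v) y" for y
      by (rule crossed_hom_move[OF comm, symmetric])
    then have "crossed_hom e w x = e a x + e (letter_inv a) (x - abelianise [a])
        + crossed_hom e (u @ v) (x - abelianise [a] - abelianise [letter_inv a])"
      by (simp add: Cons w' del: abelianise_simps)
    also have "\<dots> = crossed_hom e (u @ v) x"
      using cancellingD[OF canc, of a x] unfolding abelianise_letter_inv by (simp del: abelianise_simps)
    also have "abelianise w = abelianise [a] + abelianise u + abelianise [letter_inv a] + abelianise v"
      using abelianise_append[of "[a]" w'] abelianise_append[of u "letter_inv a # v"]
        abelianise_append[of "[letter_inv a]" v] Cons w' by (simp del: abelianise_simps)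
    then have "abelianise (u @ v) = 0"
      using "1.prems" unfolding abelianise_letter_inv abelianise_append by simp
    then have "crossed_hom e (u @ v) x = 0"
      using "1.IH" Cons w' by simp
    finally show ?thesis .
  qed simp
qed

lemma commuting_sym: "commuting e a b \<longleftrightarrow> commuting e b a"
  unfolding commuting_def by metis

lemma commuting_inv:
  assumes "cancelling e" "commuting e a b"
  shows "commuting e (letter_inv a) b"
  unfolding commuting_def
proof
  fix x
  let ?A = "abelianise [a]" and ?B = "abelianise [b]"
  have "x + ?A - ?A = x" "x + ?A - ?B - ?A = x - ?B"
    by simp_all
  then show "e (letter_inv a) x + e b (x - abelianise [letter_inv a]) = e b x + e (letter_inv a) (x - ?B)"
    using cancellingD[OF assms(1), of a "x + ?A"] cancellingD[OF assms(1), of a "x + ?A - ?B"]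
      commutingD[OF assms(2), of "x + ?A"]
    unfolding abelianise_letter_inv by (simp del: abelianise_simps)
qed

lemma commuting_all:
  fixes e :: "2 \<times> bool \<Rightarrow> int ^ 2 \<Rightarrow> int"
  assumes canc: "cancelling e" and comm: "commuting e (1, True) (2, True)"
  shows "commuting e a b"
proof -
  have flip: "letter_inv (i, s) = (i, \<not> s)" for i :: 2 and s
    by (simp add: letter_inv_def)
  have self: "commuting e (i, True) (i, s)" for i s
  proof (cases s)
    case True
    then show ?thesis by (simp add: commuting_def)
  next
    case False
    have "commuting e (letter_inv (i, True)) (i, True)"
      by (rule commuting_inv[OF canc]) (simp add: commuting_def)
    then show ?thesis
      using False by (simp add: flip commuting_sym)
  qed
  have pos: "commuting e (i, True) (j, True)" for i j
    using exhaust_2[of i] exhaust_2[of j] comm self commuting_sym by metis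
  have half: "commuting e (i, s) (j, True)" for i j s
    using pos commuting_inv[OF canc pos[of i j]] by (cases s) (simp_all add: flip)
  have "commuting e (j, t) (i, s)" for i j s t
    using half commuting_inv[OF canc half[of i s j, unfolded commuting_sym[of e "(i, s)"]]]
    by (cases t) (simp_all add: flip commuting_sym[of e "(j, True)"])
  then show ?thesis
    by (cases a; cases b) simp
qed

text \<open>The contribution of an edge at \<open>x\<close> is the signed number of its crossings with the ray that goes up
  from the puncture at \<open>x\<close>, which lies in the interior of the unit square with lower left corner \<open>x\<close>.
  Only horizontal edges contribute; the edge from the origin to \<open>(1, 0)\<close> crosses the rays of the
  punctures at the points below the origin on the vertical axis. For a closed word the total is the
  winding number around the puncture, counted positive in the clockwise sense.\<close>

definition ray_crossing :: "2 \<times> bool \<Rightarrow> int ^ 2 \<Rightarrow> int"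
  where "ray_crossing a x =
    (if fst a = 1 \<and> x $ 1 = (if snd a then 0 else - 1) \<and> x $ 2 < 0 then letter_sign a else 0)"

abbreviation wind :: "(2 \<times> bool) list \<Rightarrow> int ^ 2 \<Rightarrow> int"
  where "wind \<equiv> crossed_hom ray_crossing"

lemma cancelling_ray_crossing: "cancelling ray_crossing"
  by (auto simp: cancelling_def ray_crossing_def abelianise_Cons letter_inv_def letter_sign_def axis_def)

lemmas wind_mult = crossed_hom_mult[OF cancelling_ray_crossing]

lemma wind_inv:
  assumes "reduced w"
  shows "wind (w\<^sup>-) x = - wind w (x + abelianise w)"
proof -
  have "wind (w \<star> w\<^sup>-) (x + abelianise w) = 0"
    using assms by simp
  then show ?thesis
    using wind_mult[of w "w\<^sup>-" "x + abelianise w"] by simp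
qed

lemma wind_conj:
  assumes "reduced g" "reduced w" "abelianise w = 0"
  shows "wind (g \<star> w \<star> g\<^sup>-) x = wind w (x - abelianise g)"
  using assms by (simp add: wind_mult wind_inv abelianise_mult abelianise_inv)

lemma wind_commutator: "wind (gen 2 \<star> gen 1 \<star> (gen 2)\<^sup>- \<star> (gen 1)\<^sup>-) x = of_bool (x = 0)"
  by (auto simp: wind_mult abelianise_mult abelianise_inv inv_gen ray_crossing_def letter_sign_def axis_def
      vec_eq_iff forall_2)

definition det2 :: "int ^ 2 \<Rightarrow> int ^ 2 \<Rightarrow> int"
  where "det2 x y = x $ 1 * y $ 2 - x $ 2 * y $ 1"

text \<open>Under a Nielsen move the commutator changes at most by conjugation and inversion. Conjugation
  moves \<open>c\<close>, and inversion changes the sign in step with the determinant.\<close>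

lemma nielsen_wind_commutator:
  assumes "F2_nielsen u v"
  shows "\<exists>c. \<forall>x. wind (v \<star> u \<star> v\<^sup>- \<star> u\<^sup>-) x = det2 (abelianise u) (abelianise v) * of_bool (x = c)"
  using assms
proof induction
  case nielsen_refl
  have "det2 (abelianise (gen 1)) (abelianise (gen 2)) = 1"
    by (simp add: det2_def axis_def)
  then show ?case
    using wind_commutator by auto
next
  case (nielsen_swap u v)
  have red: "reduced u" "reduced v"
    using free.nielsen_closed[OF nielsen_swap(1)] by simp_all
  let ?k = "v \<star> u \<star> v\<^sup>- \<star> u\<^sup>-"
  have "u \<star> v \<star> u\<^sup>- \<star> v\<^sup>- = ?k\<^sup>-"
    using red by (simp add: free_word_simps)
  moreover have "abelianise ?k = 0" "reduced ?k"
    using red by (simp_all add: abelianise_mult abelianise_inv)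
  then have "wind (?k\<^sup>-) x = - wind ?k x" for x
    by (simp add: wind_inv)
  moreover obtain c where "\<forall>x. wind ?k x = det2 (abelianise u) (abelianise v) * of_bool (x = c)"
    using nielsen_swap by blast
  ultimately show ?case
    by (intro exI[of _ c]) (simp add: det2_def algebra_simps)
next
  case (nielsen_inv u v)
  have red: "reduced u" "reduced v"
    using free.nielsen_closed[OF nielsen_inv(1)] by simp_all
  let ?k = "v \<star> u \<star> v\<^sup>- \<star> u\<^sup>-"
  have "v \<star> u\<^sup>- \<star> v\<^sup>- \<star> u\<^sup>-\<^sup>- = u\<^sup>- \<star> ?k\<^sup>- \<star> u\<^sup>-\<^sup>-"
    using red by (simp add: free_word_simps)
  moreover have k: "abelianise ?k = 0" "reduced ?k"
    using red by (simp_all add: abelianise_mult abelianise_inv)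
  then have "wind (u\<^sup>- \<star> ?k\<^sup>- \<star> u\<^sup>-\<^sup>-) x = - wind ?k (x - abelianise (u\<^sup>-))" for x
    using wind_conj[of "u\<^sup>-" "?k\<^sup>-"] red by (simp add: wind_inv abelianise_inv)
  moreover obtain c where "\<forall>x. wind ?k x = det2 (abelianise u) (abelianise v) * of_bool (x = c)"
    using nielsen_inv by blast
  ultimately show ?case
    using red by (intro exI[of _ "c + abelianise (u\<^sup>-)"])
      (simp add: det2_def algebra_simps abelianise_inv diff_eq_eq eq_diff_eq)
next
  case (nielsen_mult u v)
  have red: "reduced u" "reduced v"
    using free.nielsen_closed[OF nielsen_mult(1)] by simp_all
  have "v \<star> (u \<star> v) \<star> v\<^sup>- \<star> (u \<star> v)\<^sup>- = v \<star> u \<star> v\<^sup>- \<star> u\<^sup>-"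
    using red by (simp add: free_word_simps)
  moreover have "det2 (abelianise (u \<star> v)) (abelianise v) = det2 (abelianise u) (abelianise v)"
    by (simp add: det2_def abelianise_mult algebra_simps)
  ultimately show ?case
    using nielsen_mult by simp
next
  case (nielsen_conj u v g)
  have red: "reduced u" "reduced v" "reduced g"
    using free.nielsen_closed[OF nielsen_conj(1)] nielsen_conj(2) by simp_all
  let ?k = "v \<star> u \<star> v\<^sup>- \<star> u\<^sup>-"
  have "(g \<star> v \<star> g\<^sup>-) \<star> (g \<star> u \<star> g\<^sup>-) \<star> (g \<star> v \<star> g\<^sup>-)\<^sup>- \<star> (g \<star> u \<star> g\<^sup>-)\<^sup>- = g \<star> ?k \<star> g\<^sup>-"
    using red by (simp add: free_word_simps)
  moreover have k: "abelianise ?k = 0" "reduced ?k"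
    using red by (simp_all add: abelianise_mult abelianise_inv)
  then have "wind (g \<star> ?k \<star> g\<^sup>-) x = wind ?k (x - abelianise g)" for x
    using wind_conj red by blast
  moreover obtain c where "\<forall>x. wind ?k x = det2 (abelianise u) (abelianise v) * of_bool (x = c)"
    using nielsen_conj by blast
  ultimately show ?case
    using red by (intro exI[of _ "c + abelianise g"]) (simp add: abelianise_conj diff_eq_eq)
qed

text \<open>The inverse is written out as the adjugate, which has integral entries.\<close>

lemma sl2_inverse:
  fixes A :: "int ^ 2 ^ 2"
  assumes "det A = 1"
  obtains B where "A ** B = mat 1" "B ** A = mat 1" "det B = 1"
proof
  define B :: "int ^ 2 ^ 2" where "B = (\<chi> i j. if i = j then A $ (if i = 1 then 2 else 1) $ (if i = 1 then 2 else 1)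
    else - A $ i $ j)"
  have d: "A $ 1 $ 1 * A $ 2 $ 2 - A $ 1 $ 2 * A $ 2 $ 1 = 1"
    using assms by (simp add: det_2)
  show "A ** B = mat 1" "B ** A = mat 1"
    using d by (simp_all add: vec_eq_iff forall_2 matrix_matrix_mult_def sum_2 B_def mat_def algebra_simps)
  show "det B = 1"
    using d by (simp add: det_2 B_def algebra_simps)
qed

lemma sl2_inj:
  fixes A :: "int ^ 2 ^ 2"
  assumes "det A = 1"
  shows "A *v x = A *v y \<longleftrightarrow> x = y"
  using sl2_inverse[OF assms] by (metis matrix_vector_mul_assoc matrix_vector_mul_lid)

text \<open>Both sides are crossed homomorphisms in \<open>w\<close> for the same action, the left one because \<open>\<phi>\<close> acts on
  exponent vectors through its matrix. With \<open>c\<close> taken from the winding function of the image of the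
  commutator they agree on the commutator of the generators. So their difference is commuting, and
  vanishes on closed words.\<close>

lemma auto_wind:
  assumes \<phi>: "\<phi> \<in> auto F2" and det: "det (abel_matrix \<phi>) = 1"
  shows "\<exists>c. \<forall>w x. reduced w \<longrightarrow> abelianise w = 0 \<longrightarrow> wind (\<phi> w) (abel_matrix \<phi> *v x + c) = wind w x"
proof -
  let ?A = "abel_matrix \<phi>"
  let ?k = "gen (2 :: 2) \<star> gen 1 \<star> (gen 2)\<^sup>- \<star> (gen 1)\<^sup>-"
  have red: "reduced (\<phi> w)" if "reduced w" for w
    using free.auto_closed[OF \<phi>] that by simp
  have mult: "\<phi> (u \<star> v) = \<phi> u \<star> \<phi> v" if "reduced u" "reduced v" for u v
    using free.auto_mult[OF \<phi>] that by simp
  have ab: "abelianise (\<phi> w) = ?A *v abelianise w" if "reduced w" for w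
    using abelianise_hom[OF auto_hom[OF \<phi>]] that by simp
  have "det2 (abelianise (\<phi> (gen 1))) (abelianise (\<phi> (gen 2))) = 1"
    using det by (simp add: det_2 abel_matrix_def det2_def mult.commute)
  moreover have "\<phi> ?k = \<phi> (gen 2) \<star> \<phi> (gen 1) \<star> (\<phi> (gen 2))\<^sup>- \<star> (\<phi> (gen 1))\<^sup>-"
    using free.auto_inv[OF \<phi>, of "gen _"] by (simp add: mult)
  ultimately obtain c where c: "\<And>x. wind (\<phi> ?k) x = of_bool (x = c)"
    using nielsen_wind_commutator[OF auto_nielsen[OF \<phi>]] by auto
  define e where "e a x = wind (\<phi> [a]) (?A *v x + c)" for a x
  have e_mult: "wind (\<phi> (u \<star> v)) (?A *v x + c) = wind (\<phi> u) (?A *v x + c) + wind (\<phi> v) (?A *v (x - abelianise u) + c)"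
    if "reduced u" "reduced v" for u v x
    using that by (simp add: mult wind_mult ab matrix_vector_mult_diff_distrib algebra_simps)
  have \<phi>_one: "\<phi> [] = []"
    using group_hom.hom_one[OF free.auto_group_hom[OF \<phi>]] by simp
  have e: "wind (\<phi> w) (?A *v x + c) = crossed_hom e w x" if "reduced w" for w x
    using that
  proof (induction w arbitrary: x)
    case Nil
    show ?case by (simp add: \<phi>_one)
  next
    case (Cons a w)
    then have w: "reduced w" "[a] \<star> w = a # w"
      using reduced_tl[of a w] mult_append[of "[a]" w] by simp_all
    then have "wind (\<phi> (a # w)) (?A *v x + c) = e a x + wind (\<phi> w) (?A *v (x - abelianise [a]) + c)"
      using e_mult[of "[a]" w x] by (simp only: e_def w(2)) simp
    then show ?case
      by (simp only: crossed_hom.simps Cons.IH[OF w(1)])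
  qed
  define d where "d a x = e a x - ray_crossing a x" for a x
  have d: "crossed_hom d w x = crossed_hom e w x - wind w x" for w x
    by (induction w arbitrary: x) (simp_all add: d_def)
  have "cancelling e"
    unfolding cancelling_def
  proof (intro allI)
    fix a :: "2 \<times> bool" and x
    have "[a] \<star> [letter_inv a] = []"
      by (simp add: free_mult)
    then show "e a x + e (letter_inv a) (x - abelianise [a]) = 0"
      using e_mult[of "[a]" "[letter_inv a]" x] by (simp add: e_def \<phi>_one del: abelianise_simps)
  qed
  then have canc: "cancelling d"
    using cancellingD[OF cancelling_ray_crossing] cancellingD[of e] unfolding cancelling_def d_def
    by (metis (no_types, lifting) add_diff_add diff_0_right)
  have comm: "commuting d (1, True) (2, True)"
    unfolding commuting_def
  proof
    fix x
    let ?a = "gen (1 :: 2)" and ?b = "gen (2 :: 2)"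
    have k: "reduced ?k" "abelianise ?k = 0" 
      by (simp_all add: abelianise_mult abelianise_inv)
    have ba: "?b \<star> ?a = ?k \<star> (?a \<star> ?b)"
      by (simp add: free_word_simps)
    have "wind (\<phi> (?b \<star> ?a)) (?A *v x + c) = of_bool (?A *v x + c = c) + wind (\<phi> (?a \<star> ?b)) (?A *v x + c)"
      using e_mult[of ?k "?a \<star> ?b" x] k by (subst ba) (simp add: c)
    also have "?A *v x + c = c \<longleftrightarrow> x = 0"
      using sl2_inj[OF det, of x 0] by simp
    finally have 1: "wind (\<phi> (?b \<star> ?a)) (?A *v x + c) = of_bool (x = 0) + wind (\<phi> (?a \<star> ?b)) (?A *v x + c)" .
    have 2: "wind (?b \<star> ?a) x = of_bool (x = 0) + wind (?a \<star> ?b) x"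
      using wind_mult[of ?k "?a \<star> ?b" x] k(2) by (subst ba) (simp only: wind_commutator diff_0_right)
    show "d (1, True) x + d (2, True) (x - abelianise ?a) = d (2, True) x + d (1, True) (x - abelianise ?b)"
      using 1 2 e_mult[of ?a ?b x] e_mult[of ?b ?a x] wind_mult[of ?a ?b x] wind_mult[of ?b ?a x]
      by (simp add: d_def e_def del: abelianise_simps)
  qed
  have "wind (\<phi> w) (?A *v x + c) = wind w x" if "reduced w" "abelianise w = 0" for w x
    using crossed_hom_closed_eq_0[OF canc commuting_all[OF canc comm] that(2), of x] d e[OF that(1)] by simp
  then show ?thesis by blast
qed

text \<open>Composing with a conjugation moves \<open>c\<close> to the origin.\<close>

lemma Out_representative_fixing_wind:
  assumes \<phi>: "\<phi> \<in> auto F2" and det: "det (abel_matrix \<phi>) = 1"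
  obtains \<psi> where "\<psi> \<in> auto F2" "abel_matrix \<psi> = abel_matrix \<phi>"
    "Inn F2 #>\<^bsub>AutoGroup F2\<^esub> \<psi> = Inn F2 #>\<^bsub>AutoGroup F2\<^esub> \<phi>"
    "\<And>w x. reduced w \<Longrightarrow> abelianise w = 0 \<Longrightarrow> wind (\<psi> w) (abel_matrix \<phi> *v x) = wind w x"
proof -
  let ?A = "abel_matrix \<phi>"
  obtain c where c: "\<And>w x. reduced w \<Longrightarrow> abelianise w = 0 \<Longrightarrow> wind (\<phi> w) (?A *v x + c) = wind w x"
    using auto_wind[OF assms] by blast
  have "- c \<in> abelianise ` carrier F2"
    by (simp only: abelianise_surj UNIV_I)
  then obtain g where g: "reduced g" "abelianise g = - c"
    by auto
  then have gc: "g \<in> carrier F2" by simp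
  define \<psi> where "\<psi> = compose (carrier F2) (conj_by F2 g) \<phi>"
  have "\<psi> \<in> auto F2"
    unfolding \<psi>_def by (rule free.auto_mult_closed[OF free.conj_by_auto[OF gc] \<phi>])
  moreover have "abel_matrix \<psi> = ?A"
    unfolding \<psi>_def abel_matrix_compose[OF free.conj_by_auto[OF gc] \<phi>] abel_matrix_conj_by[OF gc] by simp
  moreover have "Inn F2 #>\<^bsub>AutoGroup F2\<^esub> \<psi> = Inn F2 #>\<^bsub>AutoGroup F2\<^esub> \<phi>"
  proof (rule group.repr_independence[OF free.AutoGroup, symmetric])
    show "\<psi> \<in> Inn F2 #>\<^bsub>AutoGroup F2\<^esub> \<phi>"
      unfolding free.Out_coset_eq[OF \<phi>] \<psi>_def using gc by blast
    show "\<phi> \<in> carrier (AutoGroup F2)" using \<phi> by simp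
    show "subgroup (Inn F2) (AutoGroup F2)"
      by (rule normal_imp_subgroup[OF free.Inn_normal])
  qed
  moreover have "wind (\<psi> w) (?A *v x) = wind w x" if "reduced w" "abelianise w = 0" for w x
  proof -
    have "reduced (\<phi> w)" "abelianise (\<phi> w) = 0"
      using free.auto_closed[OF \<phi>, of w] abelianise_hom[OF auto_hom[OF \<phi>], of w] that by simp_all
    then have "wind (\<psi> w) (?A *v x) = wind (\<phi> w) (?A *v x + c)"
      using that g wind_conj[of g "\<phi> w" "?A *v x"] by (simp add: \<psi>_def compose_def conj_by_def)
    then show ?thesis
      using c that by simp
  qed
  ultimately show ?thesis
    using that by blast
qed

section \<open>A free orbit of functions on the lattice\<close>

text \<open>By the parallelogram law, \<open>a\<close> and \<open>a + 2 k b\<close> can both be at most as long as \<open>b\<close> only if \<open>k = 0\<close>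
  or \<open>a + 2 k b = - a\<close>, and the latter makes \<open>a\<close> and \<open>b\<close> parallel.\<close>

lemma short_translate_unique:
  fixes a b c :: "int ^ 2" and k :: int
  assumes det: "det2 a b \<noteq> 0"
    and a: "(a $ 1)\<^sup>2 + (a $ 2)\<^sup>2 \<le> (b $ 1)\<^sup>2 + (b $ 2)\<^sup>2"
    and c: "(c $ 1)\<^sup>2 + (c $ 2)\<^sup>2 \<le> (b $ 1)\<^sup>2 + (b $ 2)\<^sup>2"
    and c_eq: "c $ 1 = a $ 1 + 2 * k * b $ 1" "c $ 2 = a $ 2 + 2 * k * b $ 2"
  shows "k = 0"
proof (rule ccontr)
  assume k: "k \<noteq> 0"
  let ?n = "(b $ 1)\<^sup>2 + (b $ 2)\<^sup>2"
  have "(a $ 1 + c $ 1)\<^sup>2 + (a $ 2 + c $ 2)\<^sup>2 =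
      2 * ((a $ 1)\<^sup>2 + (a $ 2)\<^sup>2) + 2 * ((c $ 1)\<^sup>2 + (c $ 2)\<^sup>2) - 4 * (k\<^sup>2 * ?n)"
    unfolding c_eq by (simp add: power2_eq_square algebra_simps)
  moreover have "?n \<le> k\<^sup>2 * ?n"
  proof -
    have "1 \<le> k\<^sup>2"
      using k by (metis one_le_power int_one_le_iff_zero_less zero_less_power2)
    then show ?thesis
      using mult_right_mono[of 1 "k\<^sup>2" ?n] by simp
  qed
  moreover have "s \<le> 0" if "s = 2 * p + 2 * q - 4 * m" "n \<le> m" "p \<le> n" "q \<le> n" for s p q m n :: int
    using that by linarith
  ultimately have "(a $ 1 + c $ 1)\<^sup>2 + (a $ 2 + c $ 2)\<^sup>2 \<le> 0"
    using a c by blast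
  then have "a $ 1 + c $ 1 = 0" "a $ 2 + c $ 2 = 0"
    by (simp_all add: sum_power2_le_zero_iff)
  then have "a $ 1 = - k * b $ 1" "a $ 2 = - k * b $ 2"
    unfolding c_eq by simp_all
  then have "det2 a b = 0"
    by (simp add: det2_def)
  then show False using det by simp
qed

text \<open>A vector parallel to a primitive vector \<open>z\<close> is an integral multiple of it; Cramer's rule for the basis
  \<open>s\<close>, \<open>z\<close> gives the factor.\<close>

lemma collinear_with_unimodular:
  fixes s1 s2 z1 z2 d1 d2 :: int
  assumes det: "s1 * z2 - s2 * z1 = 1" and col: "d1 * z2 = d2 * z1"
  shows "d1 = (s1 * d2 - s2 * d1) * z1" "d2 = (s1 * d2 - s2 * d1) * z2"
proof -
  have "(s1 * d2 - s2 * d1) * z1 = s1 * (d2 * z1) - s2 * d1 * z1"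
    by (simp add: algebra_simps)
  also have "\<dots> = d1 * (s1 * z2 - s2 * z1)"
    unfolding col[symmetric] by (simp add: algebra_simps)
  finally show "d1 = (s1 * d2 - s2 * d1) * z1"
    using det by simp
  have "(s1 * d2 - s2 * d1) * z2 = s1 * z2 * d2 - s2 * (d1 * z2)"
    by (simp add: algebra_simps)
  also have "\<dots> = d2 * (s1 * z2 - s2 * z1)"
    unfolding col by (simp add: algebra_simps)
  finally show "d2 = (s1 * d2 - s2 * d1) * z2"
    using det by simp
qed

definition source :: "int ^ 2 ^ 2 \<Rightarrow> int ^ 2"
  where "source A = A *v (\<chi> i. if i = 1 then 1 else 0)"

definition target :: "int ^ 2 ^ 2 \<Rightarrow> int ^ 2"
  where "target A = A *v (\<chi> i. if i = 1 then 1 else 2)"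

text \<open>Doubling the target separates the two kinds of points, because sources are primitive vectors. The vector
  \<open>(1, 2)\<close> is chosen to make the determinant of source and target \<open>2\<close>: matrices with the same target
  then have sources that differ by even multiples of it, and likewise with the roles exchanged, as
  \<open>short_translate_unique\<close> requires.\<close>

definition marking :: "int ^ 2 ^ 2 \<Rightarrow> int ^ 2 \<Rightarrow> int"
  where "marking A x = of_bool (x = source A) + of_bool (x = 2 *s target A)"

abbreviation sqnorm :: "int ^ 2 \<Rightarrow> int"
  where "sqnorm x \<equiv> (x $ 1)\<^sup>2 + (x $ 2)\<^sup>2"

lemma source_nth: "source A $ i = A $ i $ 1"
  by (simp add: source_def matrix_vector_mult_def sum_2)

lemma target_nth: "target A $ i = A $ i $ 1 + 2 * A $ i $ 2"
  by (simp add: target_def matrix_vector_mult_def sum_2)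

lemma det2_source_target: "det A = 1 \<Longrightarrow> det2 (source A) (target A) = 2"
  by (simp add: det_2 det2_def source_nth target_nth algebra_simps)

text \<open>The matrices with a given target form a coset of an infinite cyclic group, in which the source changes
  by even multiples of the target; at most one of them has a source no longer than the target.\<close>

lemma eq_if_target_eq:
  assumes A: "det A = 1" and B: "det B = 1" and eq: "target A = target B"
    and le: "sqnorm (source A) \<le> sqnorm (target A)" "sqnorm (source B) \<le> sqnorm (target A)"
  shows "A = B"
proof -
  define d where "d i = A $ i $ 2 - B $ i $ 2" for i
  have B1: "B $ i $ 1 = A $ i $ 1 + 2 * d i" for i
    using arg_cong[OF eq, of "\<lambda>v. v $ i"] by (simp add: target_nth d_def)
  have B2: "B $ i $ 2 = A $ i $ 2 - d i" for i
    by (simp add: d_def)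
  have dA: "A $ 1 $ 1 * A $ 2 $ 2 - A $ 1 $ 2 * A $ 2 $ 1 = 1"
    using A by (simp add: det_2)
  have dB: "B $ 1 $ 1 * B $ 2 $ 2 - B $ 1 $ 2 * B $ 2 $ 1 = 1"
    using B by (simp add: det_2)
  define k where "k = (A $ 1 $ 1 + A $ 1 $ 2) * d 2 - (A $ 2 $ 1 + A $ 2 $ 2) * d 1"
  have det_d: "d 1 * target A $ 2 = d 2 * target A $ 1"
    using dA dB unfolding B1 B2 target_nth by (simp add: algebra_simps)
  \<comment> \<open>The first vector of the unimodular basis is the sum of the two columns of \<open>A\<close>.\<close>
  have d: "d i = k * target A $ i" for i
  proof -
    have "(A $ 1 $ 1 + A $ 1 $ 2) * target A $ 2 - (A $ 2 $ 1 + A $ 2 $ 2) * target A $ 1 = 1"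
      using dA by (simp add: target_nth algebra_simps)
    then have "d 1 = k * target A $ 1" "d 2 = k * target A $ 2"
      unfolding k_def using det_d by (rule collinear_with_unimodular)+
    then show ?thesis
      using exhaust_2[of i] by auto
  qed
  have "k = 0"
  proof (rule short_translate_unique[OF _ le])
    show "det2 (source A) (target A) \<noteq> 0"
      using det2_source_target[OF A] by simp
  qed (simp_all add: source_nth B1 d)
  then show ?thesis
    by (simp add: vec_eq_iff forall_2 B1 B2 d)
qed

lemma eq_if_source_eq:
  assumes A: "det A = 1" and B: "det B = 1" and eq: "source A = source B"
    and le: "sqnorm (target A) \<le> sqnorm (source A)" "sqnorm (target B) \<le> sqnorm (source A)"
  shows "A = B"
proof -
  define d where "d i = B $ i $ 2 - A $ i $ 2" for i
  have B1: "B $ i $ 1 = A $ i $ 1" for i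
    using arg_cong[OF eq, of "\<lambda>v. v $ i"] by (simp add: source_nth)
  have B2: "B $ i $ 2 = A $ i $ 2 + d i" for i
    by (simp add: d_def)
  have dA: "A $ 1 $ 1 * A $ 2 $ 2 - A $ 1 $ 2 * A $ 2 $ 1 = 1"
    using A by (simp add: det_2)
  have dB: "B $ 1 $ 1 * B $ 2 $ 2 - B $ 1 $ 2 * B $ 2 $ 1 = 1"
    using B by (simp add: det_2)
  define k where "k = - A $ 1 $ 2 * d 2 - - A $ 2 $ 2 * d 1"
  have det_d: "A $ 1 $ 1 * d 2 = A $ 2 $ 1 * d 1"
    using dA dB unfolding B1 B2 by (simp add: algebra_simps)
  \<comment> \<open>The first vector of the unimodular basis is the negative of the second column of \<open>A\<close>.\<close>
  have d: "d i = k * source A $ i" for i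
  proof -
    have "- A $ 1 $ 2 * A $ 2 $ 1 - - A $ 2 $ 2 * A $ 1 $ 1 = 1" "d 1 * A $ 2 $ 1 = d 2 * A $ 1 $ 1"
      using dA det_d by (simp_all add: algebra_simps)
    then have "d 1 = k * source A $ 1" "d 2 = k * source A $ 2"
      unfolding k_def source_nth by (rule collinear_with_unimodular)+
    then show ?thesis
      using exhaust_2[of i] by auto
  qed
  have "k = 0"
  proof (rule short_translate_unique[OF _ le])
    show "det2 (target A) (source A) \<noteq> 0"
      using det2_source_target[OF A] by (simp add: det2_def algebra_simps)
  qed (simp_all add: target_nth B1 B2 d source_nth)
  then show ?thesis
    by (simp add: vec_eq_iff forall_2 B1 B2 d)
qed

lemma source_odd:
  assumes "det A = 1"
  shows "source A \<noteq> 2 *s v"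
proof
  assume *: "source A = 2 *s v"
  have "A $ i $ 1 = 2 * v $ i" for i
    using arg_cong[OF *, of "\<lambda>v. v $ i"] by (simp add: source_nth)
  then have "2 * (v $ 1 * A $ 2 $ 2 - A $ 1 $ 2 * v $ 2) = 1"
    using assms by (simp add: det_2 algebra_simps)
  then show False by presburger
qed

lemma target_nonzero: "det A = 1 \<Longrightarrow> target A \<noteq> 0"
  using det2_source_target[of A] by (auto simp: det2_def)

lemma source_nonzero: "det A = 1 \<Longrightarrow> source A \<noteq> 0"
  using det2_source_target[of A] by (auto simp: det2_def)

lemma double_eq_iff: "(2 :: int) *s x = 2 *s y \<longleftrightarrow> x = y"
  by (simp add: vec_eq_iff)

text \<open>In the support of a relation, choose a matrix \<open>B\<close> for which the longer one of source and target is as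
  long as possible. At the point of that end no other matrix of the support contributes.\<close>

theorem markings_independent:
  assumes "finite S" and det: "\<And>A. A \<in> S \<Longrightarrow> det A = 1"
    and zero: "\<And>x. x \<noteq> 0 \<Longrightarrow> (\<Sum>A\<in>S. r A * marking A x) = 0"
    and "A \<in> S"
  shows "r A = (0 :: int)"
proof (rule ccontr)
  assume "r A \<noteq> 0"
  define T where "T = {A \<in> S. r A \<noteq> 0}"
  have T: "finite T" "T \<noteq> {}" "T \<subseteq> S"
    using assms(1,4) \<open>r A \<noteq> 0\<close> by (auto simp: T_def)
  define size where "size A = max (sqnorm (source A)) (sqnorm (target A))" for A
  have "Max (size ` T) \<in> size ` T"
    using T by (intro Max_in) auto
  then obtain B where B: "B \<in> T" "size B = Max (size ` T)"
    by (metis imageE)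
  then have max: "size C \<le> size B" if "C \<in> T" for C
    using that T(1) by simp
  have detB: "det B = 1"
    using B T det by blast
  obtain x where x: "x \<noteq> 0" "\<And>C. C \<in> T \<Longrightarrow> marking C x = of_bool (C = B)"
  proof (cases "sqnorm (source B) \<le> sqnorm (target B)")
    case True
    have "marking C (2 *s target B) = of_bool (C = B)" if C: "C \<in> T" for C
    proof -
      have detC: "det C = 1"
        using C T det by blast
      have "C = B" if "target C = target B"
        using eq_if_target_eq[OF detB detC] that max[OF C] True by (simp add: size_def)
      then show ?thesis
        using source_odd[OF detC, of "target B"] by (auto simp: marking_def double_eq_iff)
    qed
    moreover have "2 *s target B \<noteq> 0"
      using target_nonzero[OF detB] by (simp add: vec_eq_iff)
    ultimately show ?thesis
      using that by blast
  next
    case False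
    have "marking C (source B) = of_bool (C = B)" if C: "C \<in> T" for C
    proof -
      have detC: "det C = 1"
        using C T det by blast
      have "C = B" if "source C = source B"
        using eq_if_source_eq[OF detB detC] that max[OF C] False by (simp add: size_def)
      then show ?thesis
        using source_odd[OF detB, of "target C"] by (auto simp: marking_def)
    qed
    then show ?thesis
      using that source_nonzero[OF detB] by blast
  qed
  have "(\<Sum>A\<in>S. r A * marking A x) = (\<Sum>A\<in>T. r A * marking A x)"
    using assms(1) by (intro sum.mono_neutral_right) (auto simp: T_def)
  also have "\<dots> = (\<Sum>A\<in>T. if A = B then r A else 0)"
    using x(2) by (intro sum.cong) auto
  also have "\<dots> = r B"
    using T B by simp
  finally show False
    using zero[OF x(1)] B by (simp add: T_def)
qed

section \<open>The subgroup attached to a set of matrices\<close>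

text \<open>The factor \<open>2\<close> keeps the values away from the origin even, which singles out the origin.\<close>

inductive_set marked_span :: "(int ^ 2 ^ 2) set \<Rightarrow> (int ^ 2 \<Rightarrow> int) set" for H
  where
    marked_span_zero: "(\<lambda>x. 0) \<in> marked_span H"
  | marked_span_origin: "f \<in> marked_span H \<Longrightarrow> (\<lambda>x. f x + n * of_bool (x = 0)) \<in> marked_span H"
  | marked_span_marking: "f \<in> marked_span H \<Longrightarrow> A \<in> H \<Longrightarrow> (\<lambda>x. f x + n * (2 * marking A x)) \<in> marked_span H"

lemma marked_span_add:
  assumes "f \<in> marked_span H" "f' \<in> marked_span H"
  shows "(\<lambda>x. f x + f' x) \<in> marked_span H"
  using assms(2,1)
proof induction
  case marked_span_zero
  then show ?case by simp
next
  case (marked_span_origin f' n)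
  then show ?case
    using marked_span.marked_span_origin[of "\<lambda>x. f x + f' x" H n] by (simp add: add.assoc)
next
  case (marked_span_marking f' A n)
  then show ?case
    using marked_span.marked_span_marking[of "\<lambda>x. f x + f' x" H A n] by (simp add: add.assoc)
qed

lemma marked_span_uminus:
  assumes "f \<in> marked_span H"
  shows "(\<lambda>x. - f x) \<in> marked_span H"
  using assms
proof induction
  case marked_span_zero
  then show ?case using marked_span.marked_span_zero by simp
next
  case (marked_span_origin f n)
  then show ?case
    using marked_span.marked_span_origin[of "\<lambda>x. - f x" H "- n"] by simp
next
  case (marked_span_marking f A n)
  then show ?case
    using marked_span.marked_span_marking[of "\<lambda>x. - f x" H A "- n"] by simp
qed

lemma matrix_source: "source (A ** B) = A *v source B"
  by (simp add: source_def matrix_vector_mul_assoc)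

lemma matrix_target: "target (A ** B) = A *v target B"
  by (simp add: target_def matrix_vector_mul_assoc)

lemma matrix_double: "(A :: int ^ 2 ^ 2) *v (2 *s x) = 2 *s (A *v x)"
  by (simp add: vec_eq_iff matrix_vector_mult_def sum_2 algebra_simps)

lemma marking_mult:
  assumes "det A = 1"
  shows "marking (A ** B) (A *v x) = marking B x"
  unfolding marking_def matrix_source matrix_target matrix_double[symmetric] sl2_inj[OF assms] ..

lemma marked_span_comp:
  assumes f: "f \<in> marked_span H" and A: "det A = 1" and H: "\<And>B. B \<in> H \<Longrightarrow> \<exists>C\<in>H. B = A ** C"
  shows "(\<lambda>x. f (A *v x)) \<in> marked_span H"
  using f
proof induction
  case marked_span_zero
  then show ?case by (rule marked_span.marked_span_zero)
next
  case (marked_span_origin f n)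
  have "A *v x = 0 \<longleftrightarrow> x = 0" for x
    using sl2_inj[OF A, of x 0] by simp
  then show ?case
    using marked_span.marked_span_origin[OF marked_span_origin.IH, of n] by simp
next
  case (marked_span_marking f B n)
  obtain C where "C \<in> H" "B = A ** C"
    using H marked_span_marking by blast
  then show ?case
    using marked_span.marked_span_marking[OF marked_span_marking.IH, of C n] by (simp add: marking_mult[OF A])
qed

text \<open>The value at the origin is left out, as it can be changed at will.\<close>

lemma marked_span_expansion:
  assumes "f \<in> marked_span H"
  shows "\<exists>S r. finite S \<and> S \<subseteq> H \<and> (\<forall>x. x \<noteq> 0 \<longrightarrow> f x = 2 * (\<Sum>A\<in>S. r A * marking A x))"
  using assms
proof induction
  case marked_span_zero
  show ?case by (intro exI[of _ "{}"]) simp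
next
  case (marked_span_origin f n)
  then show ?case by auto
next
  case (marked_span_marking f B n)
  then obtain S r where S: "finite S" "S \<subseteq> H"
    and f: "\<And>x. x \<noteq> 0 \<Longrightarrow> f x = 2 * (\<Sum>A\<in>S. r A * marking A x)"
    by blast
  define r' where "r' A = (if A \<in> S then r A else 0) + (if A = B then n else 0)" for A
  have "(\<Sum>A\<in>insert B S. r' A * marking A x) = (\<Sum>A\<in>S. r A * marking A x) + n * marking B x" for x
  proof -
    have "(\<Sum>A\<in>insert B S. r' A * marking A x) =
        (\<Sum>A\<in>insert B S. if A \<in> S then r A * marking A x else 0) +
        (\<Sum>A\<in>insert B S. if A = B then n * marking A x else 0)"
      unfolding sum.distrib[symmetric] r'_def by (intro sum.cong) (auto simp: algebra_simps)
    also have "(\<Sum>A\<in>insert B S. if A \<in> S then r A * marking A x else 0) = (\<Sum>A\<in>S. r A * marking A x)"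
      using S(1) by (intro sum.mono_neutral_cong_right) auto
    also have "(\<Sum>A\<in>insert B S. if A = B then n * marking A x else 0) = n * marking B x"
      using S(1) by (subst sum.delta) auto
    finally show ?thesis .
  qed
  then have "f x + n * (2 * marking B x) = 2 * (\<Sum>A\<in>insert B S. r' A * marking A x)" if "x \<noteq> 0" for x
    using f[OF that] by (simp add: algebra_simps)
  then show ?case
    using S marked_span_marking.hyps(2) by (intro exI[of _ "insert B S"] exI[of _ r']) auto
qed

lemma marking_in_marked_span:
  assumes B: "det B = 1" and H: "\<And>A. A \<in> H \<Longrightarrow> det A = 1"
    and mem: "(\<lambda>x. 2 * marking B x) \<in> marked_span H"
  shows "B \<in> H"
proof (rule ccontr)
  assume nB: "B \<notin> H"
  obtain S r where S: "finite S" "S \<subseteq> H"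
    and eq: "\<And>x. x \<noteq> 0 \<Longrightarrow> 2 * marking B x = 2 * (\<Sum>A\<in>S. r A * marking A x)"
    using marked_span_expansion[OF mem] by blast
  define r' where "r' A = (if A = B then - 1 else r A)" for A
  have "B \<notin> S"
    using nB S by blast
  then have "(\<Sum>A\<in>S. r' A * marking A x) = (\<Sum>A\<in>S. r A * marking A x)" for x
    by (intro sum.cong) (auto simp: r'_def)
  then have "(\<Sum>A\<in>insert B S. r' A * marking A x) = 0" if "x \<noteq> 0" for x
    using S \<open>B \<notin> S\<close> eq[OF that] by (simp add: r'_def)
  then have "r' B = 0"
    using markings_independent[of "insert B S" r' B] S B H by blast
  then show False by (simp add: r'_def)
qed

lemma indicator_in_marked_span:
  assumes "(\<lambda>x. of_bool (x = v)) \<in> marked_span H"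
  shows "v = 0"
proof (rule ccontr)
  assume "v \<noteq> 0"
  then obtain S r where "(1 :: int) = 2 * (\<Sum>A\<in>S. r A * marking A v)"
    using marked_span_expansion[OF assms] by force
  then show False by presburger
qed

definition winding_subgroup :: "(int ^ 2 \<Rightarrow> int) set \<Rightarrow> (2 \<times> bool) list set"
  where "winding_subgroup M = {w. reduced w \<and> abelianise w = 0 \<and> wind w \<in> M}"

lemma subgroup_winding_subgroup: "subgroup (winding_subgroup (marked_span H)) F2"
proof (rule free.subgroupI)
  have "wind [] = (\<lambda>x. 0)"
    by (rule ext) simp
  then have "[] \<in> winding_subgroup (marked_span H)"
    using marked_span_zero by (simp add: winding_subgroup_def)
  then show "winding_subgroup (marked_span H) \<noteq> {}"
    by blast
next
  fix w assume w: "w \<in> winding_subgroup (marked_span H)"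
  then have "wind (w\<^sup>-) = (\<lambda>x. - wind w x)"
    by (intro ext) (simp add: winding_subgroup_def wind_inv)
  then show "w\<^sup>- \<in> winding_subgroup (marked_span H)"
    using w marked_span_uminus by (simp add: winding_subgroup_def abelianise_inv)
next
  fix u w assume uw: "u \<in> winding_subgroup (marked_span H)" "w \<in> winding_subgroup (marked_span H)"
  then have "wind (u \<star> w) = (\<lambda>x. wind u x + wind w x)"
    by (intro ext) (simp add: winding_subgroup_def wind_mult)
  then show "u \<star> w \<in> winding_subgroup (marked_span H)"
    using uw marked_span_add by (simp add: winding_subgroup_def abelianise_mult)
qed (auto simp: winding_subgroup_def)

lemma wind_indicator: "\<exists>w. reduced w \<and> abelianise w = 0 \<and> wind w = (\<lambda>x. of_bool (x = v))"
proof -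
  let ?k = "gen (2 :: 2) \<star> gen 1 \<star> (gen 2)\<^sup>- \<star> (gen 1)\<^sup>-"
  have "v \<in> abelianise ` carrier F2"
    by (simp only: abelianise_surj UNIV_I)
  then obtain g where g: "reduced g" "abelianise g = v"
    by auto
  have k: "reduced ?k" "abelianise ?k = 0"
    by (simp_all add: abelianise_mult abelianise_inv)
  have "wind (g \<star> ?k \<star> g\<^sup>-) = (\<lambda>x. of_bool (x = v))"
    unfolding wind_conj[OF g(1) k, abs_def] wind_commutator g(2) by simp
  moreover have "abelianise (g \<star> ?k \<star> g\<^sup>-) = 0"
    unfolding abelianise_conj[OF g(1)] by (rule k(2))
  moreover have "reduced (g \<star> ?k \<star> g\<^sup>-)"
    using g by simp
  ultimately show ?thesis by blast
qed

text \<open>The word is built from two words around single punctures, so that all functions needed to compare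
  two subgroups are known to be winding functions.\<close>

lemma wind_double_marking: "\<exists>w. reduced w \<and> abelianise w = 0 \<and> wind w = (\<lambda>x. 2 * marking A x)"
proof -
  obtain u v where u: "reduced u" "abelianise u = 0" "wind u = (\<lambda>x. of_bool (x = source A))"
    and v: "reduced v" "abelianise v = 0" "wind v = (\<lambda>x. of_bool (x = 2 *s target A))"
    using wind_indicator by metis
  have "wind (u \<star> v \<star> (u \<star> v)) = (\<lambda>x. 2 * marking A x)"
    by (rule ext) (use u v in \<open>simp add: wind_mult abelianise_mult marking_def\<close>)
  then show ?thesis
    using u v by (intro exI[of _ "u \<star> v \<star> (u \<star> v)"]) (simp add: abelianise_mult)
qed

text \<open>The constant \<open>c\<close> is kept to cover inner automorphisms, which act by translations, as well.\<close>

lemma image_winding_subgroup: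
  assumes \<psi>: "\<psi> \<in> auto F2" and A: "A = abel_matrix \<psi>" "det A = 1"
    and wind: "\<And>w x. reduced w \<Longrightarrow> abelianise w = 0 \<Longrightarrow> wind (\<psi> w) (A *v x + c) = wind w x"
  shows "\<psi> ` winding_subgroup M = {w. reduced w \<and> abelianise w = 0 \<and> (\<lambda>x. wind w (A *v x + c)) \<in> M}"
proof -
  have ab: "abelianise (\<psi> w) = 0 \<longleftrightarrow> abelianise w = 0" if "reduced w" for w
    using abelianise_hom[OF auto_hom[OF \<psi>], of w] sl2_inj[OF A(2), of "abelianise w" 0] that A(1) by simp
  have red: "reduced (\<psi> w)" if "reduced w" for w
    using free.auto_closed[OF \<psi>, of w] that by simp
  have mem: "\<psi> w \<in> {w. reduced w \<and> abelianise w = 0 \<and> (\<lambda>x. wind w (A *v x + c)) \<in> M} \<longleftrightarrow> w \<in> winding_subgroup M"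
    if "reduced w" for w
    using that ab red wind[of w] by (auto simp: winding_subgroup_def)
  have surj: "\<exists>v. reduced v \<and> w = \<psi> v" if "reduced w" for w
  proof -
    have "w \<in> \<psi> ` carrier F2"
      using \<psi> that by (simp add: auto_def Bij_def bij_betw_def)
    then show ?thesis by auto
  qed
  show ?thesis
  proof (intro equalityI subsetI)
    fix y assume "y \<in> \<psi> ` winding_subgroup M"
    then obtain w where "y = \<psi> w" "w \<in> winding_subgroup M"
      by blast
    moreover have "reduced w"
      using \<open>w \<in> winding_subgroup M\<close> by (simp add: winding_subgroup_def)
    ultimately show "y \<in> {w. reduced w \<and> abelianise w = 0 \<and> (\<lambda>x. wind w (A *v x + c)) \<in> M}"
      using mem by blast
  next
    fix y assume y: "y \<in> {w. reduced w \<and> abelianise w = 0 \<and> (\<lambda>x. wind w (A *v x + c)) \<in> M}"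
    then obtain v where "reduced v" "y = \<psi> v"
      using surj by blast
    then show "y \<in> \<psi> ` winding_subgroup M"
      using mem y by blast
  qed
qed

lemma conj_image_winding_subgroup:
  assumes "reduced g"
  shows "conj_by F2 g ` winding_subgroup M =
    {w. reduced w \<and> abelianise w = 0 \<and> (\<lambda>x. wind w (x + abelianise g)) \<in> M}"
proof -
  have g: "g \<in> carrier F2"
    using assms by simp
  have "wind (conj_by F2 g w) (mat 1 *v x + abelianise g) = wind w x"
    if "reduced w" "abelianise w = 0" for w x
    using wind_conj[OF assms that] that by (simp add: conj_by_def)
  then show ?thesis
    using image_winding_subgroup[OF free.conj_by_auto[OF g], of "mat 1" "abelianise g" M]
      abel_matrix_conj_by[OF g] by simp
qed

section \<open>Subgroups of the oriented outer automorphism group as stabilisers\<close>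

lemma Out_coset_eq_if_abel_matrix_eq:
  assumes \<phi>: "\<phi> \<in> auto F2" and \<psi>: "\<psi> \<in> auto F2" and eq: "abel_matrix \<phi> = abel_matrix \<psi>"
  shows "Inn F2 #>\<^bsub>AutoGroup F2\<^esub> \<phi> = Inn F2 #>\<^bsub>AutoGroup F2\<^esub> \<psi>"
proof -
  interpret A: group "AutoGroup F2"
    by (rule free.AutoGroup)
  have sub: "subgroup (Inn F2) (AutoGroup F2)"
    by (rule normal_imp_subgroup[OF free.Inn_normal])
  let ?i = "inv\<^bsub>AutoGroup F2\<^esub> \<psi>"
  have i: "?i \<in> auto F2"
    using A.inv_closed[of \<psi>] \<psi> by simp
  have "abel_matrix \<psi> ** abel_matrix ?i = abel_matrix (\<psi> \<otimes>\<^bsub>AutoGroup F2\<^esub> ?i)"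
    using abel_matrix_compose[OF \<psi> i] \<psi> i by simp
  also have "\<dots> = mat 1"
    using A.r_inv[of \<psi>] \<psi> abel_matrix_id by simp
  finally have "abel_matrix (compose (carrier F2) \<phi> ?i) = mat 1"
    using abel_matrix_compose[OF \<phi> i] eq by simp
  then have "compose (carrier F2) \<phi> ?i \<in> Inn F2"
    by (intro auto_inner_if_abel_matrix_trivial free.auto_mult_closed \<phi> i)
  then have "\<phi> \<otimes>\<^bsub>AutoGroup F2\<^esub> ?i \<in> Inn F2"
    using \<phi> i by simp
  moreover have "\<phi> = \<phi> \<otimes>\<^bsub>AutoGroup F2\<^esub> ?i \<otimes>\<^bsub>AutoGroup F2\<^esub> \<psi>"
    using \<phi> \<psi> i A.m_assoc[of \<phi> ?i \<psi>] A.l_inv[of \<psi>] A.r_one[of \<phi>] by (metis AutoGroup_simps(1))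
  ultimately have "\<phi> \<in> Inn F2 #>\<^bsub>AutoGroup F2\<^esub> \<psi>"
    unfolding r_coset_def by blast
  then show ?thesis
    using A.repr_independence[OF _ _ sub] \<psi> by simp
qed

text \<open>If the matrix \<open>A\<close> of \<open>\<psi>\<close> is in \<open>H\<close>, it preserves the span of the markings. Conversely, suppose
  that \<open>\<psi>\<close> maps the subgroup to its conjugate by \<open>g\<close>. Testing this on the indicator of a point shows
  that \<open>g\<close> has exponent vector \<open>0\<close>, and then testing it on the marking of the identity shows that the
  inverse of \<open>A\<close> is in \<open>H\<close>. Together with \<open>mat 1 \<in> H\<close>, the last hypothesis makes \<open>H\<close> a group.\<close>

lemma conj_class_fixed_iff:
  assumes \<psi>: "\<psi> \<in> auto F2" and det: "det (abel_matrix \<psi>) = 1"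
    and wind: "\<And>w x. reduced w \<Longrightarrow> abelianise w = 0 \<Longrightarrow> wind (\<psi> w) (abel_matrix \<psi> *v x) = wind w x"
    and H_det: "\<And>A. A \<in> H \<Longrightarrow> det A = 1" and H_one: "mat 1 \<in> H"
    and H_div: "\<And>A B. A \<in> H \<Longrightarrow> B \<in> H \<Longrightarrow> \<exists>C\<in>H. B = A ** C"
  shows "conj_class F2 (\<psi> ` winding_subgroup (marked_span H)) = conj_class F2 (winding_subgroup (marked_span H))
    \<longleftrightarrow> abel_matrix \<psi> \<in> H"
proof
  let ?A = "abel_matrix \<psi>" and ?M = "marked_span H"
  let ?U = "winding_subgroup ?M"
  have U: "subgroup ?U F2"
    by (rule subgroup_winding_subgroup)
  have img: "\<psi> ` ?U = {w. reduced w \<and> abelianise w = 0 \<and> (\<lambda>x. wind w (?A *v x)) \<in> ?M}"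
    using image_winding_subgroup[OF \<psi> refl det, of 0 ?M] wind by simp
  {
    assume A: "?A \<in> H"
    obtain B where B: "B \<in> H" "mat 1 = ?A ** B"
      using H_div[OF A H_one] by blast
    have "(\<lambda>x. f (?A *v x)) \<in> ?M \<longleftrightarrow> f \<in> ?M" for f
    proof
      assume "(\<lambda>x. f (?A *v x)) \<in> ?M"
      then have "(\<lambda>x. f (?A *v (B *v x))) \<in> ?M"
        by (rule marked_span_comp[OF _ H_det[OF B(1)] H_div[OF B(1)]])
      then show "f \<in> ?M"
        by (simp add: matrix_vector_mul_assoc flip: B(2))
    qed (rule marked_span_comp[OF _ det H_div[OF A]])
    then have "\<psi> ` ?U = ?U"
      unfolding img by (simp add: winding_subgroup_def)
    then show "conj_class F2 (\<psi> ` ?U) = conj_class F2 ?U"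
      by simp
  next
    assume eq: "conj_class F2 (\<psi> ` ?U) = conj_class F2 ?U"
    have "\<psi> ` ?U \<in> conj_class F2 (\<psi> ` ?U)"
    proof -
      have sub: "subgroup (\<psi> ` ?U) F2"
        by (rule free.auto_subgroup[OF \<psi> U])
      have "conj_by F2 [] w = w" if "reduced w" for w :: "(2 \<times> bool) list"
        using that by (simp add: conj_by_def inv_eq_word_inv)
      then have "conj_by F2 [] ` \<psi> ` ?U = \<psi> ` ?U"
        using subgroup.subset[OF sub] by (force simp: image_iff)
      moreover have "[] \<in> carrier F2"
        by simp
      ultimately show ?thesis
        unfolding free.conj_class_eq[OF sub] by blast
    qed
    then obtain g where g: "reduced g" "\<psi> ` ?U = conj_by F2 g ` ?U"
      unfolding eq free.conj_class_eq[OF U] by auto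
    define t where "t = abelianise g"
    have iff: "(\<lambda>x. wind w (?A *v x)) \<in> ?M \<longleftrightarrow> (\<lambda>x. wind w (x + t)) \<in> ?M"
      if "reduced w" "abelianise w = 0" for w
      using g(2) that unfolding img conj_image_winding_subgroup[OF g(1)] t_def by blast
    obtain B where B: "?A ** B = mat 1" "B ** ?A = mat 1" "det B = 1"
      using sl2_inverse[OF det] .
    have Bx: "?A *v x = y \<longleftrightarrow> x = B *v y" for x y
      using B(1,2) by (metis matrix_vector_mul_assoc matrix_vector_mul_lid)
    have t: "t = 0"
    proof -
      obtain w where w: "reduced w" "abelianise w = 0" "wind w = (\<lambda>x. of_bool (x = t))"
        using wind_indicator by blast
      have "(\<lambda>x. of_bool (x = 0)) \<in> ?M"
        using marked_span_origin[OF marked_span_zero, where n = 1] by simp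
      then have "(\<lambda>x. of_bool (x = B *v t)) \<in> ?M"
        using iff[OF w(1,2)] by (simp add: w(3) Bx)
      then have "B *v t = 0"
        by (rule indicator_in_marked_span)
      then show ?thesis
        using sl2_inj[OF B(3), of t 0] by simp
    qed
    obtain w where w: "reduced w" "abelianise w = 0" "wind w = (\<lambda>x. 2 * marking (mat 1) x)"
      using wind_double_marking by blast
    have "(\<lambda>x. 2 * marking (mat 1) x) \<in> ?M"
      using marked_span_marking[OF marked_span_zero H_one, where n = 1] by simp
    then have "(\<lambda>x. 2 * marking (?A ** B) (?A *v x)) \<in> ?M"
      using iff[OF w(1,2)] by (simp add: w(3) t B(1))
    then have "(\<lambda>x. 2 * marking B x) \<in> ?M"
      by (simp add: marking_mult[OF det])
    then have "B \<in> H"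
      using marking_in_marked_span[OF B(3) H_det] by blast
    then obtain C where "C \<in> H" "mat 1 = B ** C"
      using H_div[OF _ H_one] by blast
    moreover have "?A = ?A ** (B ** C)"
      using \<open>mat 1 = B ** C\<close> by (metis matrix_mul_rid)
    ultimately show "?A \<in> H"
      using B(1) by (metis matrix_mul_assoc matrix_mul_lid)
  }
qed

theorem corollary1p1:
  assumes "subgroup H Out_plus_F2"
  shows "\<exists>U. subgroup U F2 \<and> H = stabilizer Out_plus_F2 (out_action F2) (conj_class F2 U)"
proof -
  let ?c = "\<lambda>\<phi>. Inn F2 #>\<^bsub>AutoGroup F2\<^esub> \<phi>"
  interpret O: group "Out F2"
    by (rule free.group_Out)
  have ops: "x \<otimes>\<^bsub>Out_plus_F2\<^esub> y = x \<otimes>\<^bsub>Out F2\<^esub> y" "\<one>\<^bsub>Out_plus_F2\<^esub> = \<one>\<^bsub>Out F2\<^esub>" for x y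
    by (simp_all add: Out_plus_F2_def)
  interpret P: group Out_plus_F2
    using O.subgroup_imp_group[OF subgroup_Out_plus_F2] by (simp add: Out_plus_F2_def)
  interpret H: subgroup H Out_plus_F2
    by (rule assms)
  have rep: "\<exists>\<phi>\<in>auto F2. \<Phi> = ?c \<phi> \<and> det (abel_matrix \<phi>) = 1" if "\<Phi> \<in> carrier Out_plus_F2" for \<Phi>
  proof -
    have "\<Phi> \<in> carrier (Out F2)"
      using that by (simp add: Out_plus_F2_def)
    then obtain \<phi> where "\<phi> \<in> auto F2" "\<Phi> = ?c \<phi>"
      unfolding free.carrier_Out by blast
    then show ?thesis
      using that Out_plus_F2_iff by blast
  qed
  define M where "M = {abel_matrix \<phi> | \<phi>. \<phi> \<in> auto F2 \<and> ?c \<phi> \<in> H}"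
  have M_iff: "abel_matrix \<phi> \<in> M \<longleftrightarrow> ?c \<phi> \<in> H" if "\<phi> \<in> auto F2" for \<phi>
  proof
    assume "abel_matrix \<phi> \<in> M"
    then obtain \<psi> where "abel_matrix \<phi> = abel_matrix \<psi>" "\<psi> \<in> auto F2" "?c \<psi> \<in> H"
      unfolding M_def by blast
    then show "?c \<phi> \<in> H"
      by (simp only: Out_coset_eq_if_abel_matrix_eq[OF that, of \<psi>])
  qed (use that in \<open>unfold M_def, blast\<close>)
  have M_det: "det A = 1" if A: "A \<in> M" for A
  proof -
    obtain \<phi> where \<phi>: "A = abel_matrix \<phi>" "\<phi> \<in> auto F2" "?c \<phi> \<in> H"
      using A unfolding M_def by blast
    have "?c \<phi> \<in> carrier Out_plus_F2"
      by (rule subsetD[OF H.subset \<phi>(3)])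
    then show ?thesis
      unfolding \<phi>(1) Out_plus_F2_iff[OF \<phi>(2)] .
  qed
  have M_one: "mat 1 \<in> M"
  proof -
    have "?c \<one>\<^bsub>AutoGroup F2\<^esub> = Inn F2"
      using group.coset_mult_one[OF free.AutoGroup] subgroup.subset
        normal_imp_subgroup[OF free.Inn_normal] by blast
    then have "?c (\<lambda>w\<in>carrier F2. w) = \<one>\<^bsub>Out_plus_F2\<^esub>"
      unfolding ops by (simp add: Out_def FactGroup_def)
    then show ?thesis
      using M_iff[OF free.id_in_auto] H.one_closed unfolding abel_matrix_id by simp
  qed
  have M_div: "\<exists>C\<in>M. B = A ** C" if AB: "A \<in> M" "B \<in> M" for A B
  proof -
    obtain \<phi> \<psi> where \<phi>: "\<phi> \<in> auto F2" "A = abel_matrix \<phi>" "?c \<phi> \<in> H"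
      and \<psi>: "\<psi> \<in> auto F2" "B = abel_matrix \<psi>" "?c \<psi> \<in> H"
      using AB unfolding M_def by blast
    have quot: "inv\<^bsub>Out_plus_F2\<^esub> (?c \<phi>) \<otimes>\<^bsub>Out_plus_F2\<^esub> ?c \<psi> \<in> H"
      using \<phi>(3) \<psi>(3) by blast
    then obtain \<theta> where \<theta>: "\<theta> \<in> auto F2" "inv\<^bsub>Out_plus_F2\<^esub> (?c \<phi>) \<otimes>\<^bsub>Out_plus_F2\<^esub> ?c \<psi> = ?c \<theta>"
      using rep H.subset by blast
    have "?c \<psi> = ?c \<phi> \<otimes>\<^bsub>Out_plus_F2\<^esub> ?c \<theta>"
      unfolding \<theta>(2)[symmetric]
      using P.mult_inv_cancel(1)[OF subsetD[OF H.subset \<phi>(3)] subsetD[OF H.subset \<psi>(3)]] by (rule sym)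
    then have coset_eq: "?c \<psi> = ?c (compose (carrier F2) \<phi> \<theta>)"
      unfolding ops free.mult_Out[OF \<phi>(1) \<theta>(1)] .
    have comp: "compose (carrier F2) \<phi> \<theta> \<in> auto F2"
      by (rule free.auto_mult_closed[OF \<phi>(1) \<theta>(1)])
    have "\<psi> \<in> ?c (compose (carrier F2) \<phi> \<theta>)"
      unfolding coset_eq[symmetric]
      using group.rcos_self[OF free.AutoGroup, of \<psi> "Inn F2"] \<psi>(1) normal_imp_subgroup[OF free.Inn_normal]
      by simp
    then obtain g where g: "g \<in> carrier F2"
        "\<psi> = compose (carrier F2) (conj_by F2 g) (compose (carrier F2) \<phi> \<theta>)"
      unfolding free.Out_coset_eq[OF comp] by blast
    have "B = A ** abel_matrix \<theta>"
      unfolding \<psi>(2) g(2) abel_matrix_compose[OF free.conj_by_auto[OF g(1)] comp]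
        abel_matrix_conj_by[OF g(1)] abel_matrix_compose[OF \<phi>(1) \<theta>(1)] \<phi>(2) by simp
    moreover have "abel_matrix \<theta> \<in> M"
      using M_iff[OF \<theta>(1)] quot \<theta>(2) by simp
    ultimately show ?thesis by blast
  qed
  let ?U = "winding_subgroup (marked_span M)"
  have U: "subgroup ?U F2"
    by (rule subgroup_winding_subgroup)
  have fixed: "out_action F2 \<Phi> (conj_class F2 ?U) = conj_class F2 ?U \<longleftrightarrow> \<Phi> \<in> H"
    if \<Phi>: "\<Phi> \<in> carrier Out_plus_F2" for \<Phi>
  proof -
    obtain \<phi> where \<phi>: "\<phi> \<in> auto F2" "\<Phi> = ?c \<phi>" "det (abel_matrix \<phi>) = 1"
      using rep[OF \<Phi>] by blast
    obtain \<psi> where \<psi>: "\<psi> \<in> auto F2" "abel_matrix \<psi> = abel_matrix \<phi>" "?c \<psi> = ?c \<phi>"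
      "\<And>w x. reduced w \<Longrightarrow> abelianise w = 0 \<Longrightarrow> wind (\<psi> w) (abel_matrix \<phi> *v x) = wind w x"
      using Out_representative_fixing_wind[OF \<phi>(1,3)] by blast
    have "out_action F2 \<Phi> (conj_class F2 ?U) = conj_class F2 (\<psi> ` ?U)"
      unfolding \<phi>(2) \<psi>(3)[symmetric] by (rule free.out_action_eq[OF \<psi>(1) U])
    also have "\<dots> = conj_class F2 ?U \<longleftrightarrow> abel_matrix \<psi> \<in> M"
      by (rule conj_class_fixed_iff[OF \<psi>(1) _ _ M_det M_one M_div]) (use \<psi> \<phi> in simp_all)
    also have "\<dots> \<longleftrightarrow> \<Phi> \<in> H"
      unfolding M_iff[OF \<psi>(1)] \<psi>(3) \<phi>(2) ..
    finally show ?thesis .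
  qed
  have "H = stabilizer Out_plus_F2 (out_action F2) (conj_class F2 ?U)"
    unfolding stabilizer_def using fixed H.subset by blast
  then show ?thesis
    using U by blast
qed

end
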